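(* Let $\zeta$ be a primitive aperiodic substitution on $\mathcal A=\{1,\ldots,m\}$, and let $\theta$ be the Perron-Frobenius eigenvalue of its substitution matrix. Suppose that $\theta$ admits a Galois conjugate $\theta_2$ (different from $\theta$) outside the unit circle, $|\theta_2|>1$. Let $(\mathfrak X_\zeta,h_t)$ be the self-similar suspension flow over the substitution dynamical system $(X_\zeta,T_\zeta)$, and for $a\in\mathcal A$ let $\sigma_a$ be the spectral measure corresponding to the cylinder set $[a]$. Then there exists $\gamma>0$ such that for any $B>1$ there exist $C_B>0$ and $r_0(B)>0$ such that $$\sigma_a([\omega-r,\omega+r])\le C_B(\log(1/r))^{-\gamma}\quad\text{for all } 0<r\le r_0(B),\ a\in\mathcal A,\ |\omega|\in[B^{-1},B].$$
   Context: Let $m\ge2$, $\mathcal A=\{1,\dots,m\}$, and let $\mathcal A^+$ be the set of nonempty finite words over $\mathcal A$. A substitution is a map $\zeta:\mathcal A\to\mathcal A^+$, extended to words and sequences by concatenation. The substitution matrix $\mathsf S$ is the $m\times m$ matrix with $\mathsf S(i,j)$ = number of symbols $i$ in $\zeta(j)$; $\zeta$ is primitive if some power $\mathsf S^n$ is entrywise strictly positive. $X_\zeta\subset\mathcal A^{\mathbb Z}$ is the set of bi-infinite sequences all of whose finite subwords occur as subwords of $\zeta^n(a)$ for some $a\in\mathcal A$, $n\in\mathbb N$; $T_\zeta$ is the left shift on $X_\zeta$. For primitive $\zeta$, aperiodic means $X_\zeta$ is infinite; $(X_\zeta,T_\zeta)$ is uniquely ergodic. For a strictly positive vector $\vec s=(s_1,\dots,s_m)$,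 the suspension flow over $T_\zeta$ is the unit-speed vertical flow $h_t$ under the roof function equal to $s_j$ on $\{x\in X_\zeta:x_0=j\}$, on the space $\{(x,t):x\in X_\zeta,\ 0\le t\le s_{x_0}\}$ with $(x,s_{x_0})$ identified with $(T_\zeta x,0)$. The self-similar suspension flow $(\mathfrak X_\zeta,h_t)$ is the one for which $\vec s$ is the (strictly positive) Perron-Frobenius eigenvector of the transpose matrix: $\mathsf S^t\vec s=\theta\vec s$. Let $\widetilde\mu$ be its unique invariant probability measure. For $f\in L^2(\mathfrak X_\zeta,\widetilde\mu)$ the spectral measure $\sigma_f$ is the finite positive Borel measure on $\mathbb R$ with $\int_{\mathbb R}e^{2\pi i\omega t}\,d\sigma_f(\omega)=\langle f\circ h_t,f\rangle$ for all $t\in\mathbb R$. The spectral measure $\sigma_a$ corresponding to the cylinder set $[a]$ is $\sigma_f$ for $f=\mathbf 1_{\mathfrak X_a}$, where $\mathfrak X_a=\{(x,t):x\in X_\zeta,\ x_0=a,\ 0\le t\le s_a\}$. *)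

theory Defs
  imports
    "HOL-Probability.Probability"
    "HOL-Computational_Algebra.Computational_Algebra"
    "HOL-Library.Sublist"
begin

text \<open>The alphabet is a finite type \<open>'a\<close>, so that \<open>m = CARD('a)\<close>; words are lists and
  bi-infinite sequences are functions \<open>int \<Rightarrow> 'a\<close>.\<close>

section \<open>Substitutions\<close>

definition substitution :: "('a \<Rightarrow> 'a list) \<Rightarrow> bool" where
  "substitution \<zeta> \<longleftrightarrow> (\<forall>a. \<zeta> a \<noteq> [])"

definition subst_word :: "('a \<Rightarrow> 'a list) \<Rightarrow> 'a list \<Rightarrow> 'a list" where
  "subst_word \<zeta> w = concat (map \<zeta> w)"

definition subst_matrix :: "('a::finite \<Rightarrow> 'a list) \<Rightarrow> real^'a^'a" where
  "subst_matrix \<zeta> = (\<chi> i j. real (count_list (\<zeta> j) i))"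

definition matrix_pow :: "real^'a^'a \<Rightarrow> nat \<Rightarrow> real^'a^'a" where
  "matrix_pow A n = (((**) A) ^^ n) (mat 1)"

definition primitive :: "('a::finite \<Rightarrow> 'a list) \<Rightarrow> bool" where
  "primitive \<zeta> \<longleftrightarrow> (\<exists>n. \<forall>i j. 0 < matrix_pow (subst_matrix \<zeta>) n $ i $ j)"

definition shift :: "int \<Rightarrow> (int \<Rightarrow> 'a) \<Rightarrow> (int \<Rightarrow> 'a)" where
  "shift n x = (\<lambda>k. x (k + n))"

definition subword :: "(int \<Rightarrow> 'a) \<Rightarrow> int \<Rightarrow> nat \<Rightarrow> 'a list" where
  "subword x i n = map (\<lambda>k. x (i + int k)) [0..<n]"

definition subst_space :: "('a \<Rightarrow> 'a list) \<Rightarrow> (int \<Rightarrow> 'a) set" where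
  "subst_space \<zeta> = {x. \<forall>i n. \<exists>a k. sublist (subword x i n) ((subst_word \<zeta> ^^ k) [a])}"

definition aperiodic :: "('a \<Rightarrow> 'a list) \<Rightarrow> bool" where
  "aperiodic \<zeta> \<longleftrightarrow> infinite (subst_space \<zeta>)"

section \<open>Perron-Frobenius eigenvalue and Galois conjugates\<close>

definition complex_eigenvalues :: "real^'a^'a \<Rightarrow> complex set" where
  "complex_eigenvalues A =
     {z. \<exists>v. v \<noteq> 0 \<and> map_matrix complex_of_real A *v v = z *s v}"

definition perron_frobenius_eigenvalue :: "real^'a^'a \<Rightarrow> real \<Rightarrow> bool" where
  "perron_frobenius_eigenvalue A \<theta> \<longleftrightarrow>
     0 < \<theta> \<and> complex_of_real \<theta> \<in> complex_eigenvalues A \<and>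
     (\<forall>z\<in>complex_eigenvalues A. z \<noteq> complex_of_real \<theta> \<longrightarrow> cmod z < \<theta>)"

definition galois_conjugate :: "complex \<Rightarrow> complex \<Rightarrow> bool" where
  "galois_conjugate x y \<longleftrightarrow>
     (\<exists>p :: rat poly. irreducible p \<and>
        poly (map_poly of_rat p) x = 0 \<and> poly (map_poly of_rat p) y = 0)"

section \<open>Suspension flow\<close>

text \<open>The quotient of \<open>{(x, t). x \<in> X \<and> 0 \<le> t \<le> s (x 0)}\<close> by \<open>(x, s (x 0)) ~ (T x, 0)\<close> is
  represented by one point of each class, the one with \<open>t < s (x 0)\<close>;
  \<open>susp_proj\<close> is the quotient map.\<close>

definition closed_boxes :: "('a::finite \<Rightarrow> 'a list) \<Rightarrow> real^'a \<Rightarrow> ((int \<Rightarrow> 'a) \<times> real) set" where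
  "closed_boxes \<zeta> s = {(x, t). x \<in> subst_space \<zeta> \<and> 0 \<le> t \<and> t \<le> s $ x 0}"

definition susp_proj :: "real^'a \<Rightarrow> (int \<Rightarrow> 'a) \<times> real \<Rightarrow> (int \<Rightarrow> 'a) \<times> real" where
  "susp_proj s = (\<lambda>(x, t). if t = s $ x 0 then (shift 1 x, 0) else (x, t))"

definition susp_space :: "('a::finite \<Rightarrow> 'a list) \<Rightarrow> real^'a \<Rightarrow> ((int \<Rightarrow> 'a) \<times> real) set" where
  "susp_space \<zeta> s = susp_proj s ` closed_boxes \<zeta> s"

definition susp_cylinder ::
  "('a::finite \<Rightarrow> 'a list) \<Rightarrow> real^'a \<Rightarrow> 'a \<Rightarrow> ((int \<Rightarrow> 'a) \<times> real) set" where
  "susp_cylinder \<zeta> s a = susp_proj s ` {(x, t) \<in> closed_boxes \<zeta> s. x 0 = a}"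

text \<open>The product sigma-algebra is the Borel sigma-algebra of the product topology, the alphabet
  being discrete; restricted to the representatives it is the Borel sigma-algebra of the
  quotient.\<close>

definition susp_algebra ::
  "('a::finite \<Rightarrow> 'a list) \<Rightarrow> real^'a \<Rightarrow> ((int \<Rightarrow> 'a) \<times> real) measure" where
  "susp_algebra \<zeta> s =
     restrict_space (PiM UNIV (\<lambda>_. count_space UNIV) \<Otimes>\<^sub>M borel) (susp_space \<zeta> s)"

text \<open>Signed height of the base point of \<open>shift n x\<close> above that of \<open>x\<close>; for each \<open>n\<close> at least one
  of the two index sets is empty.\<close>

definition height :: "real^'a \<Rightarrow> (int \<Rightarrow> 'a) \<Rightarrow> int \<Rightarrow> real" where
  "height s x n = (\<Sum>k\<in>{0..<n}. s $ x k) - (\<Sum>k\<in>{n..<0}. s $ x k)"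

definition susp_flow ::
  "real^'a \<Rightarrow> real \<Rightarrow> (int \<Rightarrow> 'a) \<times> real \<Rightarrow> (int \<Rightarrow> 'a) \<times> real" where
  "susp_flow s t = (\<lambda>(x, u).
     let n = (THE n. height s x n \<le> u + t \<and> u + t < height s x (n + 1))
     in (shift n x, u + t - height s x n))"

definition flow_invariant :: "'x measure \<Rightarrow> (real \<Rightarrow> 'x \<Rightarrow> 'x) \<Rightarrow> bool" where
  "flow_invariant M h \<longleftrightarrow> (\<forall>t. h t \<in> M \<rightarrow>\<^sub>M M \<and> distr M M (h t) = M)"

section \<open>Spectral measures\<close>

definition spectral_measure ::
  "'x measure \<Rightarrow> (real \<Rightarrow> 'x \<Rightarrow> 'x) \<Rightarrow> ('x \<Rightarrow> complex) \<Rightarrow> real measure \<Rightarrow> bool" where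
  "spectral_measure M h f \<sigma> \<longleftrightarrow>
     sets \<sigma> = sets borel \<and> finite_measure \<sigma> \<and>
     (\<forall>t. (\<integral>\<omega>. exp (2 * of_real pi * \<i> * of_real \<omega> * of_real t) \<partial>\<sigma>) =
          (\<integral>p. f (h t p) * cnj (f p) \<partial>M))"

section \<open>The flow is well defined\<close>

lemma height_0 [simp]: "height s x 0 = 0"
  by (simp add: height_def)

lemma height_Suc: "height s x (n + 1) = height s x n + s $ x n"
proof (cases "0 \<le> n")
  case True
  then have "{0..<n + 1} = insert n {0..<n}" by auto
  with True show ?thesis by (simp add: height_def)
next
  case False
  then have "{n..<0} = insert n {n + 1..<0}" by auto
  with False show ?thesis by (simp add: height_def)
qed

lemma height_ex1:
  fixes s :: "real^'a::finite"
  assumes pos: "\<And>j. 0 < s $ j"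
  shows "\<exists>!n. height s x n \<le> v \<and> v < height s x (n + 1)"
proof -
  define c where "c = Min (range (($) s))"
  have c: "0 < c" "\<And>j. c \<le> s $ j"
    using pos by (auto simp: c_def)
  have grow: "height s x n + real k * c \<le> height s x (n + int k)" for n k
  proof (induction k)
    case (Suc k)
    have "n + int (Suc k) = (n + int k) + 1" by simp
    then have "height s x (n + int (Suc k)) = height s x (n + int k) + s $ x (n + int k)"
      by (simp only: height_Suc)
    with Suc c(2)[of "x (n + int k)"] show ?case by (simp add: algebra_simps)
  qed simp
  have mono: "height s x n \<le> height s x n'" if "n \<le> n'" for n n'
  proof -
    have "0 \<le> real (nat (n' - n)) * c" using c by simp
    with grow[of n "nat (n' - n)"] that show ?thesis by simp
  qed
  obtain K where K: "\<bar>v\<bar> < real K * c" using reals_Archimedean3[OF c(1)] by blast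
  have lo: "height s x (- int K) \<le> v" using grow[of "- int K" K] K by simp
  have hi: "v < height s x (int K)" using grow[of 0 K] K by simp
  define N where "N = {n. height s x n \<le> v}"
  have sub: "n < int K" if "n \<in> N" for n
    using mono[of "int K" n] hi that by (force simp: N_def)
  define n where "n = Max (N \<inter> {- int K..})"
  have fin: "finite (N \<inter> {- int K..})"
    by (rule finite_subset[of _ "{- int K..<int K}"]) (auto dest: sub)
  have "- int K \<in> N \<inter> {- int K..}" using lo by (simp add: N_def)
  then have n: "n \<in> N \<inter> {- int K..}" unfolding n_def using fin Max_in by blast
  have "n + 1 \<notin> N"
  proof
    assume "n + 1 \<in> N"
    then have "n + 1 \<in> N \<inter> {- int K..}" using n by auto
    then have "n + 1 \<le> n" using Max_ge[OF fin] by (simp only: n_def[symmetric])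
    then show False by simp
  qed
  with n have n': "height s x n \<le> v \<and> v < height s x (n + 1)" by (auto simp: N_def)
  have "k = n" if "height s x k \<le> v \<and> v < height s x (k + 1)" for k
    using mono[of "k + 1" n] mono[of "n + 1" k] that n' by force
  with n' show ?thesis by blast
qed

end

theory Submission
  imports Defs
begin

text \<open>Fubini and the definition of the spectral measure give
  \<open>R\<^sup>2 \<sigma>\<^sub>a[\<omega> - r, \<omega> + r] \<le> 4 \<integral> |S\<^sub>R|\<^sup>2 d\<mu>\<close> with \<open>r = 1 / (6R)\<close>, where \<open>S\<^sub>R\<close> is the integral of
  \<open>exp (-2 \<pi> i \<omega> t) f \<circ> h\<^sub>t\<close> over \<open>[0, R]\<close>. Up to edge effects \<open>S\<^sub>R\<close> is a sum of blocks
  \<open>\<zeta>\<^sup>n(b)\<close> with \<open>\<theta>\<^sup>n\<close> about \<open>\<surd>R\<close>. If \<open>c v c\<close> occurs in \<open>\<zeta>\<^sup>q(b)\<close> for all \<open>b\<close>, the normalised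
  twisted sum of a block drops by a fixed factor between the levels \<open>k\<close> and \<open>k + q\<close> whenever
  \<open>\<omega> |cv| \<theta>\<^sup>k\<close> is \<open>\<epsilon>\<close>-far from the integers. This happens for some \<open>k\<close> in every \<open>[n, A n]\<close> with \<open>n\<close>
  large: otherwise the nearest integers satisfy the linear recurrence of the minimal polynomial
  throughout, and their \<open>\<theta>\<^sub>2\<close>-component, which cannot exceed a constant at the end and grows like
  \<open>|\<theta>\<^sub>2|\<^sup>k\<close>, is exponentially small in \<open>A n\<close> at the start; but it is a nonzero element of \<open>\<int>[\<theta>\<^sub>2]\<close> with
  coefficients of size \<open>O(\<theta>\<^sup>n)\<close>, hence at least \<open>c \<theta>\<^sup>-\<^sup>D\<^sup>n\<close>. So there are about \<open>log n\<close> drops up to level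
  \<open>n\<close>, which gives a factor \<open>n\<^sup>-\<^sup>\<gamma>\<close>, and \<open>n\<close> is of order \<open>log R\<close>.\<close>

section \<open>Integer polynomials at an algebraic number\<close>

abbreviation ipoly :: "int poly \<Rightarrow> complex \<Rightarrow> complex" where
  "ipoly P z \<equiv> poly (map_poly of_int P) z"

lemma ipoly_altdef:
  assumes "degree P \<le> n"
  shows "ipoly P z = (\<Sum>i\<le>n. of_int (coeff P i) * z ^ i)"
proof -
  have "degree (map_poly of_int P :: complex poly) = degree P"
    by (intro degree_map_poly) auto
  then show ?thesis
    using assms by (auto simp: poly_altdef coeff_map_poly intro!: sum.mono_neutral_left le_degree)
qed

lemma ipoly_add: "ipoly (P + Q) z = ipoly P z + ipoly Q z"
proof -
  have "(map_poly of_int (P + Q) :: complex poly) = map_poly of_int P + map_poly of_int Q"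
    by (intro poly_eqI) (simp add: coeff_map_poly)
  then show ?thesis by simp
qed

lemma ipoly_smult: "ipoly (smult c P) z = of_int c * ipoly P z"
proof -
  have "(map_poly of_int (smult c P) :: complex poly) = smult (of_int c) (map_poly of_int P)"
    by (intro poly_eqI) (simp add: coeff_map_poly)
  then show ?thesis by simp
qed

lemma ipoly_mult: "ipoly (P * Q) z = ipoly P z * ipoly Q z"
proof -
  have "(map_poly of_int (P * Q) :: complex poly) = map_poly of_int P * map_poly of_int Q"
    by (intro poly_eqI) (simp add: coeff_map_poly coeff_mult)
  then show ?thesis by simp
qed

lemma ipoly_monom: "ipoly (monom c n) z = of_int c * z ^ n"
  by (simp add: map_poly_monom poly_monom)

text \<open>Over the rationals a least-degree annihilator \<open>m\<close> of \<open>y\<close>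
  divides the irreducible polynomial \<open>q\<close>, so \<open>q\<close> is \<open>m\<close> times
  a unit and \<open>m\<close> also kills \<open>x\<close>. Every integer polynomial vanishing at
  \<open>y\<close> is a multiple of \<open>m\<close>, hence vanishes at \<open>x\<close>.\<close>

lemma galois_conjugate_minimal_polynomial:
  assumes "galois_conjugate x y"
  obtains p :: "int poly" where "p \<noteq> 0" "ipoly p x = 0" "ipoly p y = 0"
    "\<And>R. ipoly R y = 0 \<Longrightarrow> degree R < degree p \<Longrightarrow> R = 0"
proof -
  obtain q :: "rat poly" where q: "irreducible q"
    "poly (map_poly of_rat q) x = 0" "poly (map_poly of_rat q) y = 0"
    using assms unfolding galois_conjugate_def by blast
  have mult: "(map_poly of_rat (f * g) :: complex poly) = map_poly of_rat f * map_poly of_rat g"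
    for f g by (intro poly_eqI) (simp add: coeff_map_poly coeff_mult of_rat_sum of_rat_mult)
  have add: "(map_poly of_rat (f + g) :: complex poly) = map_poly of_rat f + map_poly of_rat g"
    for f g by (intro poly_eqI) (simp add: coeff_map_poly of_rat_add)
  have unit: "poly (map_poly of_rat u) z \<noteq> 0" if "is_unit u" for u :: "rat poly" and z :: complex
  proof -
    from that obtain v where "1 = u * v" ..
    then have "map_poly of_rat (u * v) = (1 :: complex poly)" by simp
    then show ?thesis by (metis mult mult_zero_left poly_1 poly_mult zero_neq_one)
  qed
  define I where "I = {f :: rat poly. f \<noteq> 0 \<and> poly (map_poly of_rat f) y = 0}"
  have "q \<in> I" using q by (auto simp: I_def irreducible_def)
  then obtain m where m: "m \<in> I" "\<And>f. degree f < degree m \<Longrightarrow> f \<notin> I"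
    using measure_induct_rule[of degree "\<lambda>f. f \<notin> I" q] by blast
  have dvd: "m dvd f" if f: "poly (map_poly of_rat f) y = 0" for f
  proof -
    have "poly (map_poly of_rat ((f div m) * m + f mod m)) y = 0"
      using f by simp
    then have "poly (map_poly of_rat (f mod m)) y = 0"
      using m(1) unfolding add mult by (simp add: I_def)
    moreover have "f mod m = 0 \<or> degree (f mod m) < degree m"
      using m(1) by (intro degree_mod_less) (auto simp: I_def)
    ultimately have "f mod m = 0" using m(2) by (auto simp: I_def)
    then show ?thesis by (simp add: dvd_eq_mod_eq_0)
  qed
  obtain g where g: "q = m * g" using dvd[OF q(3)] by blast
  have "\<not> is_unit m" using m(1) unit by (auto simp: I_def)
  then have "is_unit g" using irreducibleD[OF q(1) g] by blast
  then have mx: "poly (map_poly of_rat m) x = 0"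
    using q(2) unit[of g x] by (simp add: g mult)
  have conj: "ipoly P x = 0" if "ipoly P y = 0" for P
  proof -
    have eq: "(map_poly of_int P :: complex poly) = map_poly of_rat (map_poly of_int P)"
      by (intro poly_eqI) (simp add: coeff_map_poly)
    from that have "m dvd map_poly of_int P" by (intro dvd) (simp flip: eq)
    then obtain f where "map_poly of_int P = m * f" ..
    then show ?thesis by (simp add: eq mult mx)
  qed
  have "algebraic y"
    unfolding algebraic_altdef using q(3)
    by (intro exI[of _ "map_poly of_rat q"])
      (use q(1) in \<open>auto simp: coeff_map_poly map_poly_eq_0_iff irreducible_def\<close>)
  then obtain P0 :: "complex poly" where P0: "\<forall>i. coeff P0 i \<in> \<int>" "P0 \<noteq> 0" "poly P0 y = 0"
    unfolding algebraic_def by blast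
  then obtain P1 where P1: "P0 = map_poly of_int P1"
    by (metis intpolyE)
  define S where "S = {P :: int poly. P \<noteq> 0 \<and> ipoly P y = 0}"
  have "P1 \<in> S" using P0 P1 by (auto simp: S_def)
  then obtain p where p: "p \<in> S" "\<And>R. degree R < degree p \<Longrightarrow> R \<notin> S"
    using measure_induct_rule[of degree "\<lambda>p. p \<notin> S" P1] by blast
  show ?thesis
    by (rule that[of p]) (use p conj in \<open>auto simp: S_def\<close>)
qed

text \<open>Each division step cancels the coefficient of degree \<open>e + n\<close>, multiplies
  the coefficient bound by at most \<open>2 * H\<close>, and adds one monomial to the quotient.
  Multiplying by powers of the leading coefficient keeps quotient and remainder integral.\<close>

lemma pseudo_division_bound:
  fixes P :: "int poly" and \<alpha> :: complex
  assumes "degree P = e" "\<And>i. \<bar>real_of_int (coeff P i)\<bar> \<le> H" "1 \<le> H"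
    and "cmod \<alpha> \<le> a" "1 \<le> a" "e > 0"
  shows "degree F < e + n \<Longrightarrow> (\<And>i. \<bar>real_of_int (coeff F i)\<bar> \<le> G) \<Longrightarrow> 0 \<le> G \<Longrightarrow>
    \<exists>Q R. smult (lead_coeff P ^ n) F = Q * P + R \<and> degree R < e \<and>
      (\<forall>i. \<bar>real_of_int (coeff R i)\<bar> \<le> (2 * H) ^ n * G) \<and>
      cmod (ipoly Q \<alpha>) \<le> real n * (2 * a * H) ^ n * G"
proof (induction n arbitrary: F G)
  case 0
  then show ?case by (intro exI[of _ 0] exI[of _ F]) auto
next
  case (Suc n)
  define l where "l = lead_coeff P"
  \<comment> \<open>\<open>c\<close> may be 0: a step is taken even if nothing is to be cancelled,
    so that the power of the leading coefficient is exactly \<open>n\<close>.\<close>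
  define c where "c = coeff F (e + n)"
  define F' where "F' = smult l F - monom c n * P"
  have l: "\<bar>real_of_int l\<bar> \<le> H" and c: "\<bar>real_of_int c\<bar> \<le> G"
    using assms Suc.prems by (auto simp: l_def c_def)
  have coeff': "coeff F' i = l * coeff F i - (if n \<le> i then c * coeff P (i - n) else 0)" for i
    by (simp add: F'_def coeff_monom_mult)
  have deg: "degree F' < e + n"
  proof -
    have "coeff F' i = 0" if "i > e + n - 1" for i
    proof (cases "i = e + n")
      case True
      then show ?thesis using assms(1) by (simp add: coeff' l_def c_def)
    next
      case False
      with that have "i > e + n" by simp
      then show ?thesis using assms(1) Suc.prems(1)
        by (simp add: coeff' coeff_eq_0)
    qed
    then have "degree F' \<le> e + n - 1" by (intro degree_le) auto
    with \<open>e > 0\<close> show ?thesis by simp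
  qed
  have bd: "\<bar>real_of_int (coeff F' i)\<bar> \<le> 2 * H * G" for i
  proof -
    have "\<bar>real_of_int l * real_of_int (coeff F i)\<bar> \<le> H * G"
      unfolding abs_mult using l Suc.prems assms by (intro mult_mono) auto
    moreover have "\<bar>real_of_int c * real_of_int (coeff P (i - n))\<bar> \<le> G * H"
      unfolding abs_mult using c Suc.prems assms by (intro mult_mono) auto
    moreover have "0 \<le> H * G" using Suc.prems assms by simp
    ultimately show ?thesis unfolding coeff' by (auto simp: algebra_simps)
  qed
  have G': "0 \<le> 2 * H * G" using Suc.prems assms by simp
  from Suc.IH[OF deg bd G'] obtain Q R where QR:
    "smult (l ^ n) F' = Q * P + R" "degree R < e"
    "\<And>i. \<bar>real_of_int (coeff R i)\<bar> \<le> (2 * H) ^ n * (2 * H * G)"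
    "cmod (ipoly Q \<alpha>) \<le> real n * (2 * a * H) ^ n * (2 * H * G)"
    unfolding l_def by blast
  \<comment> \<open>The monomial found now is multiplied by \<open>l\<close> in each of the
    \<open>n\<close> remaining steps.\<close>
  define Q' where "Q' = Q + smult (l ^ n) (monom c n)"
  have "smult (l ^ Suc n) F = smult (l ^ n) F' + smult (l ^ n) (monom c n * P)"
    by (simp add: F'_def smult_diff_right mult.commute)
  also have "\<dots> = Q' * P + R"
    by (simp add: QR Q'_def algebra_simps)
  finally have 1: "smult (l ^ Suc n) F = Q' * P + R" .
  have "cmod (ipoly (smult (l ^ n) (monom c n)) \<alpha>)
      = \<bar>real_of_int l\<bar> ^ n * \<bar>real_of_int c\<bar> * cmod \<alpha> ^ n"
    by (simp add: ipoly_smult ipoly_monom norm_mult norm_power)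
  also have "\<dots> \<le> H ^ n * G * a ^ n"
    using l c assms Suc.prems by (intro mult_mono power_mono) auto
  also have "\<dots> = (a * H) ^ n * G" by (simp add: power_mult_distrib)
  also have "\<dots> \<le> (2 * a * H) ^ Suc n * G"
  proof (intro mult_right_mono)
    have 2: "1 \<le> a * H" using assms by (metis mult_mono' mult_1 zero_le_one)
    have "(a * H) ^ n \<le> (2 * a * H) ^ n" using 2 assms by (intro power_mono) auto
    also have "\<dots> \<le> (2 * a * H) ^ Suc n" using 2 by (intro power_increasing) auto
    finally show "(a * H) ^ n \<le> (2 * a * H) ^ Suc n" .
  qed (use Suc.prems in auto)
  finally have "cmod (ipoly Q' \<alpha>) \<le> real n * (2 * a * H) ^ n * (2 * H * G)
      + (2 * a * H) ^ Suc n * G"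
    unfolding Q'_def ipoly_add using QR(4)
    by (intro norm_triangle_le add_mono)
  also have "real n * (2 * a * H) ^ n * (2 * H * G) \<le> real n * (2 * a * H) ^ n * (2 * a * H * G)"
    using assms Suc.prems by (intro mult_left_mono mult_right_mono) auto
  finally have 2: "cmod (ipoly Q' \<alpha>) \<le> real (Suc n) * (2 * a * H) ^ Suc n * G"
    by (simp add: algebra_simps)
  show ?case
    by (rule exI[of _ Q'], rule exI[of _ R])
      (use 1 2 QR(2,3) in \<open>auto simp: l_def ac_simps\<close>)
qed

text \<open>A Liouville inequality; Euclid's algorithm on \<open>p\<close> and \<open>P\<close> replaces the norm of \<open>P(\<alpha>)\<close>.\<close>

lemma ipoly_lower_bound:
  fixes p :: "int poly" and \<alpha> :: complex
  assumes p: "p \<noteq> 0" "ipoly p \<alpha> = 0"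
    and minimal: "\<And>R. ipoly R \<alpha> = 0 \<Longrightarrow> degree R < degree p \<Longrightarrow> R = 0"
    and "e \<le> degree p"
  shows "\<exists>c>0. \<exists>D. \<forall>P H. degree P < e \<longrightarrow> P \<noteq> 0 \<longrightarrow> 1 \<le> H \<longrightarrow>
    (\<forall>i. \<bar>real_of_int (coeff P i)\<bar> \<le> H) \<longrightarrow> c / H ^ D \<le> cmod (ipoly P \<alpha>)"
  using \<open>e \<le> degree p\<close>
proof (induction e)
  case 0
  show ?case by (intro exI[of _ 1]) auto
next
  case (Suc e)
  then obtain c D where c: "c > 0" and IH: "\<And>P H. degree P < e \<Longrightarrow> P \<noteq> 0 \<Longrightarrow> 1 \<le> H \<Longrightarrow>
    (\<forall>i. \<bar>real_of_int (coeff P i)\<bar> \<le> H) \<Longrightarrow> c / H ^ D \<le> cmod (ipoly P \<alpha>)"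
    by (metis Suc_leD)
  show ?case
  proof (cases "e = 0")
    case True
    show ?thesis
    proof (intro exI[of _ "1::real"] exI[of _ "0::nat"] conjI allI impI)
      fix P :: "int poly" and H :: real
      assume "degree P < Suc e" "P \<noteq> 0"
      with True obtain k where "P = [:k:]" "k \<noteq> 0"
        by (metis degree_eq_zeroE less_one One_nat_def pCons_0_0)
      then have "ipoly P \<alpha> = of_int k" "1 \<le> \<bar>real_of_int k\<bar>"
        by (auto simp: map_poly_pCons)
      then show "1 / H ^ 0 \<le> cmod (ipoly P \<alpha>)" by simp
    qed simp
  next
    case False
    define G where "G = 1 + (\<Sum>i\<le>degree p. \<bar>real_of_int (coeff p i)\<bar>)"
    have G: "\<bar>real_of_int (coeff p i)\<bar> \<le> G" "1 \<le> G" for i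
    proof -
      show "1 \<le> G" by (simp add: G_def sum_nonneg)
      show "\<bar>real_of_int (coeff p i)\<bar> \<le> G"
      proof (cases "i \<le> degree p")
        case True
        then have "\<bar>real_of_int (coeff p i)\<bar> \<le> (\<Sum>i\<le>degree p. \<bar>real_of_int (coeff p i)\<bar>)"
          by (intro member_le_sum) auto
        then show ?thesis by (simp add: G_def)
      qed (use \<open>1 \<le> G\<close> in \<open>simp add: coeff_eq_0\<close>)
    qed
    define a where "a = max 1 (cmod \<alpha>)"
    define n where "n = degree p"
    have n: "n > 0" using Suc.prems by (simp add: n_def)
    define K where "K = real n * (2 * a) ^ n * G"
    have a: "1 \<le> a" by (simp add: a_def)
    have K: "K > 0" using n a G by (auto simp: K_def intro!: mult_pos_pos)
    \<comment> \<open>The bound for the remainder has \<open>(2 * H) ^ n * G\<close> in place of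
      \<open>H\<close>, and is then divided by the bound \<open>K * H ^ n\<close> for the quotient
      at \<open>\<alpha>\<close>.\<close>
    define c' where "c' = c / ((2 ^ n * G) ^ D * K)"
    have c': "c' > 0" using c K G by (auto simp: c'_def intro!: divide_pos_pos mult_pos_pos)
    define D' where "D' = n * D + n"
    have key: "c' / H ^ D' \<le> cmod (ipoly P \<alpha>)"
      if P: "degree P = e" "P \<noteq> 0" "1 \<le> H" "\<And>i. \<bar>real_of_int (coeff P i)\<bar> \<le> H" for P H
    proof -
      have "degree p < e + n" using False by (simp add: n_def)
      from pseudo_division_bound[OF P(1) P(4) P(3) _ a _ this G(1), of \<alpha>] False G(2)
      obtain Q R where QR: "smult (lead_coeff P ^ n) p = Q * P + R" "degree R < e"
        "\<And>i. \<bar>real_of_int (coeff R i)\<bar> \<le> (2 * H) ^ n * G"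
        "cmod (ipoly Q \<alpha>) \<le> real n * (2 * a * H) ^ n * G"
        by (auto simp: a_def)
      have P0: "ipoly P \<alpha> \<noteq> 0" using minimal[of P] P Suc.prems by auto
      \<comment> \<open>Since \<open>p\<close> vanishes at \<open>\<alpha>\<close>, a lower bound
        for \<open>R\<close> and an upper bound for \<open>Q\<close> give a lower bound for
        \<open>P\<close>.\<close>
      have eq: "ipoly R \<alpha> = - ipoly Q \<alpha> * ipoly P \<alpha>"
        using arg_cong[OF QR(1), of "\<lambda>f. ipoly f \<alpha>"] p
        by (simp add: ipoly_smult ipoly_add ipoly_mult add_eq_0_iff)
      \<comment> \<open>If \<open>R\<close> were 0, \<open>Q\<close> would vanish at
        \<open>\<alpha>\<close> although its degree is less than that of \<open>p\<close>, as
        \<open>P\<close> has positive degree.\<close>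
      have "R \<noteq> 0"
      proof
        assume R: "R = 0"
        then have "ipoly Q \<alpha> = 0" using eq P0 by simp
        moreover have QP: "Q * P \<noteq> 0"
          using QR(1) R P(2) p(1) by (metis add.right_neutral leading_coeff_0_iff power_not_zero smult_eq_0_iff)
        then have "degree Q + e = degree (smult (lead_coeff P ^ n) p)"
          using QR(1) R P by (auto simp: degree_mult_eq)
        then have "degree Q < degree p" using False P(2) by simp
        ultimately have "Q = 0" by (intro minimal)
        with QP show False by simp
      qed
      have H1: "1 \<le> (2 * H) ^ n * G"
        using one_le_power[of "2 * H" n] P(3) G(2) mult_mono[of 1 "(2 * H) ^ n" 1 G] by simp
      have "c / ((2 * H) ^ n * G) ^ D \<le> cmod (ipoly R \<alpha>)"
        using QR \<open>R \<noteq> 0\<close> H1 by (intro IH) auto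
      also have "\<dots> = cmod (ipoly Q \<alpha>) * cmod (ipoly P \<alpha>)"
        by (simp add: eq norm_mult)
      also have "\<dots> \<le> (real n * (2 * a * H) ^ n * G) * cmod (ipoly P \<alpha>)"
        using QR(4) by (intro mult_right_mono) auto
      also have "real n * (2 * a * H) ^ n * G = K * H ^ n"
        by (simp add: K_def power_mult_distrib)
      finally have *: "c / ((2 * H) ^ n * G) ^ D \<le> K * H ^ n * cmod (ipoly P \<alpha>)" .
      have "c' / H ^ D' = c / ((2 * H) ^ n * G) ^ D / (K * H ^ n)"
        by (simp add: c'_def D'_def power_mult_distrib power_add field_simps flip: power_mult)
      also have "\<dots> \<le> cmod (ipoly P \<alpha>)"
        using * K P(3) by (subst pos_divide_le_eq) (auto simp: algebra_simps)
      finally show ?thesis .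
    qed
    show ?thesis
    proof (intro exI[of _ "min c c'"] exI[of _ "max D D'"] conjI allI impI)
      fix P :: "int poly" and H :: real
      assume P: "degree P < Suc e" "P \<noteq> 0" "1 \<le> H" "\<forall>i. \<bar>real_of_int (coeff P i)\<bar> \<le> H"
      have "min c c' / H ^ max D D' \<le> c / H ^ D"
        using c c' P(3) by (intro frac_le power_increasing) auto
      moreover have "min c c' / H ^ max D D' \<le> c' / H ^ D'"
        using c c' P(3) by (intro frac_le power_increasing) auto
      ultimately show "min c c' / H ^ max D D' \<le> cmod (ipoly P \<alpha>)"
        using IH[of P H] key[of P H] P by (cases "degree P = e") force+
    qed (use c c' in auto)
  qed
qed

section \<open>Distance of exponential sequences to the integers\<close>

text \<open>If \<open>p(x) = (x - \<beta>) q(x)\<close>, then \<open>conj_functional p \<beta> z k\<close> is \<open>q(E) z\<close> at \<open>k\<close>, where \<open>E\<close> is the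
  shift: it extracts from a linear recurrent sequence with characteristic polynomial \<open>p\<close> its
  \<open>\<beta>\<^sup>k\<close>-component.\<close>

definition conj_functional :: "int poly \<Rightarrow> complex \<Rightarrow> (nat \<Rightarrow> complex) \<Rightarrow> nat \<Rightarrow> complex" where
  "conj_functional p \<beta> z k = (\<Sum>m<degree p. \<beta> ^ m *
     (\<Sum>i<degree p - m. of_int (coeff p (Suc (i + m))) * z (k + i)))"

lemma conj_functional_diff:
  "conj_functional p \<beta> (\<lambda>k. u k - v k) k = conj_functional p \<beta> u k - conj_functional p \<beta> v k"
  by (simp add: conj_functional_def algebra_simps sum_subtractf)

lemma conj_functional_cmult:
  "conj_functional p \<beta> (\<lambda>k. c * u k) k = c * conj_functional p \<beta> u k"
  by (simp add: conj_functional_def sum_distrib_left algebra_simps)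

text \<open>With \<open>p(E) = (E - \<beta>) q(E)\<close>, the recurrence says that
  \<open>E - \<beta>\<close> annihilates \<open>q(E) z\<close>. The proof writes this factorisation
  as a telescoping sum.\<close>

lemma conj_functional_Suc:
  assumes "ipoly p \<beta> = 0"
    and rec: "(\<Sum>i\<le>degree p. of_int (coeff p i) * z (k + i)) = 0"
  shows "conj_functional p \<beta> z (Suc k) = \<beta> * conj_functional p \<beta> z k"
proof -
  define d where "d = degree p"
  define c :: "nat \<Rightarrow> complex" where "c i = of_int (coeff p i)" for i
  \<comment> \<open>The recurrence with its first \<open>m\<close> coefficients dropped and the
    others moved down; \<open>T 0\<close> is the recurrence itself.\<close>
  define T where "T m = (\<Sum>i\<le>d - m. c (i + m) * z (k + i))" for m
  have 1: "(\<Sum>i<d - m. c (Suc (i + m)) * z (k + i)) = T (Suc m)" if "m < d" for m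
    unfolding T_def using that by (intro sum.cong) auto
  have 2: "(\<Sum>i<d - m. c (Suc (i + m)) * z (Suc k + i)) = T m - c m * z k" if "m < d" for m
    unfolding T_def by (subst sum.atMost_shift) simp
  have p: "(\<Sum>m<d. \<beta> ^ m * c m) + \<beta> ^ d * c d = 0"
    using assms(1) by (simp add: ipoly_altdef[of p d] d_def c_def algebra_simps
        flip: lessThan_Suc_atMost)
  have "conj_functional p \<beta> z (Suc k) = (\<Sum>m<d. \<beta> ^ m * (T m - c m * z k))"
    unfolding conj_functional_def using 2 by (fold d_def c_def) (intro sum.cong; simp)
  also have "\<dots> = (\<Sum>m<d. \<beta> ^ m * T m) - z k * (\<Sum>m<d. \<beta> ^ m * c m)"
    by (simp add: algebra_simps sum_subtractf sum_distrib_left)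
  also have "(\<Sum>m<d. \<beta> ^ m * c m) = - (\<beta> ^ d * c d)"
    using p by (simp add: add_eq_0_iff2)
  \<comment> \<open>Shifting the index leaves two boundary terms: \<open>T 0\<close> vanishes by the
    recurrence, and \<open>T d\<close> cancels against the term from
    \<open>p(\<beta>) = 0\<close>.\<close>
  also have "(\<Sum>m<d. \<beta> ^ m * T m) = (\<Sum>m<d. \<beta> ^ Suc m * T (Suc m)) + T 0 - \<beta> ^ d * T d"
    using sum.lessThan_Suc_shift[of "\<lambda>m. \<beta> ^ m * T m" d] by (simp add: eq_diff_eq add.commute)
  also have "T 0 = 0" using rec by (simp add: T_def d_def c_def)
  also have "T d = c d * z k" by (simp add: T_def)
  also have "(\<Sum>m<d. \<beta> ^ Suc m * T (Suc m)) = \<beta> * conj_functional p \<beta> z k"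
    unfolding conj_functional_def
    using 1 by (fold d_def c_def, subst sum_distrib_left) (intro sum.cong; simp)
  finally show ?thesis by (simp add: algebra_simps)
qed

text \<open>When \<open>k\<close> grows by 1 the value is multiplied by \<open>\<beta>\<close> and
  also by \<open>x\<close>, and these differ. This is what removes \<open>y * \<theta> ^ k\<close>
  from the functional.\<close>

lemma conj_functional_geometric:
  assumes "ipoly p \<beta> = 0" "ipoly p x = 0" "\<beta> \<noteq> x"
  shows "conj_functional p \<beta> (\<lambda>k. x ^ k) k = 0"
proof -
  have "(\<Sum>i\<le>degree p. of_int (coeff p i) * x ^ (k + i)) = x ^ k * ipoly p x"
    by (simp add: ipoly_altdef[of p "degree p"] sum_distrib_left power_add algebra_simps)
  then have "conj_functional p \<beta> (\<lambda>k. x ^ k) (Suc k) = \<beta> * conj_functional p \<beta> (\<lambda>k. x ^ k) k"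
    using assms by (intro conj_functional_Suc) auto
  moreover have "conj_functional p \<beta> (\<lambda>k. x ^ k) (Suc k) = x * conj_functional p \<beta> (\<lambda>k. x ^ k) k"
    by (simp add: conj_functional_def sum_distrib_left algebra_simps)
  ultimately show ?thesis using assms(3) by (simp add: mult_right_cancel)
qed

lemma conj_functional_bound:
  assumes "\<And>i. i < degree p \<Longrightarrow> cmod (z (k + i)) \<le> \<delta>"
  shows "cmod (conj_functional p \<beta> z k) \<le> (\<Sum>m<degree p. cmod \<beta> ^ m *
     (\<Sum>i<degree p - m. \<bar>real_of_int (coeff p (Suc (i + m)))\<bar>)) * \<delta>"
  unfolding conj_functional_def sum_distrib_right mult.assoc
  by (intro sum_norm_le, subst norm_mult, subst norm_power, intro mult_left_mono sum_norm_le)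
    (auto simp: norm_mult intro!: mult_left_mono assms)

text \<open>The coefficient of \<open>P\<close> in degree \<open>degree p - 1\<close> is
  \<open>lead_coeff p * K k\<close>, so \<open>P\<close> is nonzero and
  \<open>ipoly_lower_bound\<close> can be applied to the functional of an integer sequence.\<close>

lemma conj_functional_eq_ipoly:
  fixes K :: "nat \<Rightarrow> int"
  assumes "p \<noteq> 0" "degree p > 0" "K k \<noteq> 0"
    and "\<And>i. i < degree p \<Longrightarrow> \<bar>real_of_int (K (k + i))\<bar> \<le> M"
  obtains P where "P \<noteq> 0" "degree P < degree p"
    "conj_functional p \<beta> (\<lambda>k. of_int (K k)) k = ipoly P \<beta>"
    "\<And>i. \<bar>real_of_int (coeff P i)\<bar> \<le> (\<Sum>i\<le>degree p. \<bar>real_of_int (coeff p i)\<bar>) * M"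
proof -
  define d where "d = degree p"
  define b where "b m = (\<Sum>i<d - m. coeff p (Suc (i + m)) * K (k + i))" for m
  define P where "P = (\<Sum>m<d. monom (b m) m)"
  have coeff: "coeff P m = (if m < d then b m else 0)" for m
    by (simp add: P_def coeff_sum)
  have deg: "degree P < d"
  proof -
    have "degree P \<le> d - 1" by (rule degree_le) (auto simp: coeff)
    with assms(2) show ?thesis by (simp add: d_def)
  qed
  have "M \<ge> 0" using assms(4)[of 0] assms(2) by linarith
  have bd: "\<bar>real_of_int (b m)\<bar> \<le> (\<Sum>i\<le>d. \<bar>real_of_int (coeff p i)\<bar>) * M" if "m < d" for m
  proof -
    have "\<bar>real_of_int (b m)\<bar> \<le> (\<Sum>i<d - m. \<bar>real_of_int (coeff p (Suc (i + m)))\<bar> * M)"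
      unfolding b_def of_int_sum using assms(4)
      by (intro order_trans[OF sum_abs] sum_mono)
        (auto simp: abs_mult d_def intro!: mult_left_mono)
    also have "\<dots> = (\<Sum>i\<in>(\<lambda>i. Suc (i + m)) ` {..<d - m}. \<bar>real_of_int (coeff p i)\<bar>) * M"
      by (subst sum.reindex) (auto simp: inj_on_def sum_distrib_right)
    also have "\<dots> \<le> (\<Sum>i\<le>d. \<bar>real_of_int (coeff p i)\<bar>) * M"
      using \<open>M \<ge> 0\<close> by (intro mult_right_mono sum_mono2) auto
    finally show ?thesis .
  qed
  have "coeff P (d - 1) = lead_coeff p * K k"
    using assms(2) by (simp add: coeff b_def d_def)
  then have "P \<noteq> 0" using assms by auto
  moreover have "conj_functional p \<beta> (\<lambda>k. of_int (K k)) k = ipoly P \<beta>"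
  proof -
    have "ipoly P \<beta> = (\<Sum>m\<le>d - 1. of_int (coeff P m) * \<beta> ^ m)"
      using deg by (intro ipoly_altdef) auto
    also have "\<dots> = (\<Sum>m<d. of_int (coeff P m) * \<beta> ^ m)"
      using assms(2) by (intro sum.cong) (auto simp: d_def)
    finally show ?thesis
      by (simp add: coeff conj_functional_def b_def mult.commute flip: d_def)
  qed
  moreover have "\<bar>real_of_int (coeff P i)\<bar> \<le> (\<Sum>i\<le>d. \<bar>real_of_int (coeff p i)\<bar>) * M" for i
    using bd[of i] \<open>M \<ge> 0\<close> by (auto simp: coeff intro!: mult_nonneg_nonneg sum_nonneg)
  ultimately show ?thesis using deg that unfolding d_def by blast
qed

section \<open>Powers that leave the neighbourhood of the integers\<close>

definition dist_int :: "real \<Rightarrow> real" where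
  "dist_int y = \<bar>y - of_int (round y)\<bar>"

text \<open>\<open>\<epsilon>\<close> and \<open>A\<close> are chosen before \<open>B\<close>,
  because the exponent of the final estimate is computed from them and must not depend on
  \<open>B\<close>.\<close>

lemma powers_not_near_integers:
  fixes p :: "int poly" and \<beta> :: complex and \<theta> :: real
  assumes p: "p \<noteq> 0" "ipoly p \<beta> = 0" "ipoly p (of_real \<theta>) = 0"
    and minimal: "\<And>R. ipoly R \<beta> = 0 \<Longrightarrow> degree R < degree p \<Longrightarrow> R = 0"
    and ne: "\<beta> \<noteq> of_real \<theta>" and \<beta>: "cmod \<beta> > 1" and \<theta>: "\<theta> > 1"
  shows "\<exists>\<epsilon>>0. \<exists>A. \<forall>B>0. \<exists>n\<^sub>0. \<forall>n\<ge>n\<^sub>0. \<forall>y. 1 / B \<le> \<bar>y\<bar> \<longrightarrow> \<bar>y\<bar> \<le> B \<longrightarrow>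
    (\<exists>k\<in>{n..A * n}. \<epsilon> \<le> dist_int (y * \<theta> ^ k))"
proof -
  define d where "d = degree p"
  have d: "d > 0"
  proof (rule ccontr)
    assume "\<not> d > 0"
    then obtain c where "p = [:c:]" by (auto simp: d_def elim: degree_eq_zeroE)
    with p show False by (auto simp: map_poly_pCons)
  qed
  define N where "N = 1 + (\<Sum>i\<le>d. \<bar>real_of_int (coeff p i)\<bar>)"
  have N: "N \<ge> 1" by (simp add: N_def sum_nonneg)
  \<comment> \<open>With \<open>N * \<epsilon> < 1\<close> the defect of the recurrence at the
    nearest integers is an integer of absolute value less than 1, hence 0.\<close>
  define \<epsilon> where "\<epsilon> = 1 / (2 * N)"
  have \<epsilon>: "\<epsilon> > 0" "\<epsilon> \<le> 1 / 2" "N * \<epsilon> < 1" using N by (auto simp: \<epsilon>_def field_simps)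
  define W where "W = (\<Sum>m<d. cmod \<beta> ^ m * (\<Sum>i<d - m. \<bar>real_of_int (coeff p (Suc (i + m)))\<bar>))"
  have W: "W \<ge> 0" unfolding W_def by (intro sum_nonneg mult_nonneg_nonneg) auto
  obtain c D where c: "c > 0" and low: "\<And>P H. degree P < d \<Longrightarrow> P \<noteq> 0 \<Longrightarrow> 1 \<le> H \<Longrightarrow>
    (\<forall>i. \<bar>real_of_int (coeff P i)\<bar> \<le> H) \<Longrightarrow> c / H ^ D \<le> cmod (ipoly P \<beta>)"
    using ipoly_lower_bound[OF p(1,2) minimal order_refl] unfolding d_def by metis
  \<comment> \<open>Over \<open>A0 * n\<close> steps the growth of the
    \<open>\<beta>\<close>-component beats the Liouville denominator, of order
    \<open>\<theta> ^ (D * n)\<close>.\<close>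
  obtain A0 where A0: "\<theta> ^ D < cmod \<beta> ^ A0" using real_arch_pow[OF \<beta>] by blast
  \<comment> \<open>\<open>A * n\<close> consists of the start \<open>n\<close>, the
    \<open>A0 * n\<close> steps, and \<open>n\<close> more levels that absorb the order
    \<open>d\<close> of the recurrence and the constant \<open>Q\<close>.\<close>
  define A where "A = A0 + 2"
  have "\<exists>n\<^sub>0. \<forall>n\<ge>n\<^sub>0. \<forall>y. 1 / B \<le> \<bar>y\<bar> \<longrightarrow> \<bar>y\<bar> \<le> B \<longrightarrow>
    (\<exists>k\<in>{n..A * n}. \<epsilon> \<le> dist_int (y * \<theta> ^ k))" if "B > 0" for B
  proof -
    define B' where "B' = max B 1"
    have B': "B' \<ge> 1" "B \<le> B'" by (auto simp: B'_def)
    \<comment> \<open>\<open>Q\<close> collects the constants of the final comparison;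
      \<open>n1\<close> makes \<open>cmod \<beta> ^ n\<close> exceed \<open>Q / c\<close>, and
      \<open>n2\<close> makes \<open>\<bar>y\<bar> * \<theta> ^ n\<close> exceed 1.\<close>
    define Q where "Q = W * cmod \<beta> ^ d * (2 * N * B' * \<theta> ^ d) ^ D"
    obtain n1 where n1: "Q / c < cmod \<beta> ^ n1" using real_arch_pow[OF \<beta>] by blast
    obtain n2 where n2: "B < \<theta> ^ n2" using real_arch_pow[OF \<theta>] by blast
    show ?thesis
    proof (intro exI[of _ "max d (max n1 n2)"] allI impI)
      fix n y
      assume n: "max d (max n1 n2) \<le> n" and y: "1 / B \<le> \<bar>y\<bar>" "\<bar>y\<bar> \<le> B"
      show "\<exists>k\<in>{n..A * n}. \<epsilon> \<le> dist_int (y * \<theta> ^ k)"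
      proof (rule ccontr)
        assume "\<not> ?thesis"
        then have near: "dist_int (y * \<theta> ^ k) < \<epsilon>" if "n \<le> k" "k \<le> A * n" for k
          using that by force
        define K where "K k = round (y * \<theta> ^ k)" for k
        define E where "E k = y * \<theta> ^ k - of_int (K k)" for k
        have E: "\<bar>E k\<bar> < \<epsilon>" if "n \<le> k" "k \<le> A * n" for k
          using near[OF that] by (simp add: E_def K_def dist_int_def)
        have \<theta>p: "(\<Sum>i\<le>d. real_of_int (coeff p i) * \<theta> ^ i) = 0"
        proof -
          have "of_real (\<Sum>i\<le>d. real_of_int (coeff p i) * \<theta> ^ i) = (0 :: complex)"
            using p(3) by (simp add: ipoly_altdef[of p d] d_def)
          then show ?thesis by (simp only: of_real_eq_0_iff)
        qed
        have recK: "(\<Sum>i\<le>d. coeff p i * K (k + i)) = 0" if "n \<le> k" "k + d \<le> A * n" for k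
        proof -
          have "real_of_int (\<Sum>i\<le>d. coeff p i * K (k + i)) =
              (\<Sum>i\<le>d. real_of_int (coeff p i) * (y * \<theta> ^ (k + i) - E (k + i)))"
            by (simp add: E_def)
          also have "\<dots> = y * \<theta> ^ k * (\<Sum>i\<le>d. real_of_int (coeff p i) * \<theta> ^ i)
              - (\<Sum>i\<le>d. real_of_int (coeff p i) * E (k + i))"
            by (simp add: sum_subtractf algebra_simps power_add sum_distrib_left)
          finally have "\<bar>real_of_int (\<Sum>i\<le>d. coeff p i * K (k + i))\<bar>
              = \<bar>\<Sum>i\<le>d. real_of_int (coeff p i) * E (k + i)\<bar>"
            by (simp add: \<theta>p)
          also have "\<dots> \<le> (\<Sum>i\<le>d. \<bar>real_of_int (coeff p i)\<bar> * \<epsilon>)"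
            using that by (intro order_trans[OF sum_abs] sum_mono)
              (auto simp: abs_mult intro!: mult_left_mono less_imp_le[OF E])
          also have "\<dots> \<le> N * \<epsilon>"
            unfolding sum_distrib_right[symmetric] using \<epsilon> by (intro mult_right_mono) (auto simp: N_def)
          also have "\<dots> < 1" by fact
          finally show ?thesis by linarith
        qed
        define LK where "LK = conj_functional p \<beta> (\<lambda>k. of_int (K k))"
        have step: "LK (Suc k) = \<beta> * LK k" if "n \<le> k" "k + d \<le> A * n" for k
        proof -
          have "(\<Sum>i\<le>degree p. of_int (coeff p i) * of_int (K (k + i))) = (0 :: complex)"
            using arg_cong[OF recK[OF that], of "of_int :: int \<Rightarrow> complex"]
            by (simp add: d_def)
          then show ?thesis unfolding LK_def by (intro conj_functional_Suc p)
        qed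
        have pow: "n + j + d \<le> A * n \<Longrightarrow> LK (n + j) = \<beta> ^ j * LK n" for j
          by (induction j) (auto simp: step)
        \<comment> \<open>The recurrence window that starts at \<open>n + j\<close> ends exactly at
          \<open>A * n\<close>; \<open>d \<le> n\<close> keeps the subtraction from
          truncating.\<close>
        define j where "j = A0 * n + n - d"
        have j: "n + j + d = A * n" "j + d = A0 * n + n" using n by (auto simp: j_def A_def algebra_simps)
        \<comment> \<open>The component of \<open>y * \<theta> ^ k\<close> is zero, so
          \<open>LK\<close> sees only the rounding errors and stays bounded on the window.\<close>
        have LKE: "LK k = - conj_functional p \<beta> (\<lambda>k. of_real (E k)) k" for k
        proof -
          have "(\<lambda>k. of_real (E k)) = (\<lambda>k. of_real y * (of_real \<theta> :: complex) ^ k - of_int (K k))"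
            by (simp add: E_def fun_eq_iff)
          then show ?thesis
            using conj_functional_geometric[OF p(2,3) ne, of k]
            by (simp add: LK_def conj_functional_diff conj_functional_cmult)
        qed
        have "cmod (LK (n + j)) \<le> W * \<epsilon>"
          unfolding LKE norm_minus_cancel W_def d_def
          using j by (intro conj_functional_bound) (auto simp: d_def intro!: less_imp_le[OF E])
        also have "\<dots> \<le> W" using W \<epsilon> by (simp add: mult_left_le)
        finally have up: "cmod \<beta> ^ j * cmod (LK n) \<le> W"
          using pow[of j] j by (simp add: norm_mult norm_power)
        have \<theta>n: "B < \<theta> ^ n" using n2 power_increasing[of n2 n \<theta>] \<theta> n by linarith
        have "1 < \<bar>y\<bar> * \<theta> ^ n"
        proof -
          have "1 = 1 / B * B" using \<open>B > 0\<close> by simp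
          also have "\<dots> < \<bar>y\<bar> * \<theta> ^ n"
            using y \<theta>n \<open>B > 0\<close> by (intro mult_le_less_imp_less) auto
          finally show ?thesis .
        qed
        then have "1 < \<bar>y * \<theta> ^ n\<bar>" using \<theta> by (simp add: abs_mult)
        \<comment> \<open>The rounding error is below 1/2, too small to bring a number of modulus
          above 1 to 0.\<close>
        then have Kn: "K n \<noteq> 0"
          using E[of n] \<epsilon>(2) by (auto simp: E_def A_def)
        define M where "M = 2 * B' * \<theta> ^ (n + d)"
        have \<theta>1: "1 \<le> \<theta> ^ k" for k using \<theta> by simp
        have M: "\<bar>real_of_int (K (n + i))\<bar> \<le> M" if "i < d" for i
        proof -
          have "\<bar>y * \<theta> ^ (n + i)\<bar> \<le> B' * \<theta> ^ (n + d)"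
            unfolding abs_mult using y B' \<theta> that by (intro mult_mono) (auto intro: power_increasing)
          moreover have "1 \<le> B' * \<theta> ^ (n + d)"
            using B'(1) \<theta>1[of "n + d"] by (metis mult_mono' mult_1 zero_le_one)
          moreover have "\<bar>real_of_int (K (n + i)) - y * \<theta> ^ (n + i)\<bar> \<le> 1 / 2"
            unfolding K_def by (rule of_int_round_abs_le)
          ultimately show ?thesis unfolding M_def mult.assoc by linarith
        qed
        have M1: "1 \<le> M"
          using B'(1) \<theta>1[of "n + d"] mult_mono[of 1 B' 1 "\<theta> ^ (n + d)"] by (simp add: M_def)
        obtain P where P: "P \<noteq> 0" "degree P < d" "LK n = ipoly P \<beta>"
          "\<And>i. \<bar>real_of_int (coeff P i)\<bar> \<le> (\<Sum>i\<le>d. \<bar>real_of_int (coeff p i)\<bar>) * M"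
          using conj_functional_eq_ipoly[of p K n M \<beta>, OF p(1) _ Kn] d M
          unfolding d_def LK_def by auto
        have "c / (N * M) ^ D \<le> cmod (LK n)"
          unfolding P(3)
        proof (intro low P allI)
          show "1 \<le> N * M" using mult_mono[of 1 N 1 M] N M1 by simp
          show "\<bar>real_of_int (coeff P i)\<bar> \<le> N * M" for i
            using M1 by (intro order_trans[OF P(4)] mult_right_mono) (auto simp: N_def)
        qed
        then have "cmod \<beta> ^ j * (c / (N * M) ^ D) \<le> cmod \<beta> ^ j * cmod (LK n)"
          by (intro mult_left_mono) auto
        also note up
        finally have "cmod \<beta> ^ j * c \<le> W * (N * M) ^ D"
          using N M1 by (simp add: field_simps)
        then have "cmod \<beta> ^ d * (cmod \<beta> ^ j * c) \<le> cmod \<beta> ^ d * (W * (N * M) ^ D)"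
          by (intro mult_left_mono) auto
        also have "\<dots> = Q * (\<theta> ^ D) ^ n"
          by (simp add: Q_def M_def power_add power_mult_distrib algebra_simps
              flip: power_mult)
        also have "cmod \<beta> ^ d * (cmod \<beta> ^ j * c) = c * cmod \<beta> ^ n * (cmod \<beta> ^ A0) ^ n"
          using j(2) by (simp add: algebra_simps flip: power_add power_mult)
        \<comment> \<open>The Liouville bound at level \<open>n\<close>, propagated to the end of
          the window; the choices of \<open>A0\<close> and \<open>n1\<close> contradict it.\<close>
        finally have 1: "c * cmod \<beta> ^ n * (cmod \<beta> ^ A0) ^ n \<le> Q * (\<theta> ^ D) ^ n" .
        have "Q < c * cmod \<beta> ^ n"
        proof -
          have "Q < c * cmod \<beta> ^ n1" using n1 c by (simp add: field_simps)
          also have "\<dots> \<le> c * cmod \<beta> ^ n"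
            using n c \<beta> by (intro mult_left_mono power_increasing) auto
          finally show ?thesis .
        qed
        moreover have "Q \<ge> 0" unfolding Q_def using W N B' \<theta> by (intro mult_nonneg_nonneg) auto
        moreover have "(\<theta> ^ D) ^ n \<le> (cmod \<beta> ^ A0) ^ n" using A0 \<theta> by (intro power_mono) auto
        moreover have "0 < (\<theta> ^ D) ^ n" using \<theta> by simp
        ultimately have "Q * (\<theta> ^ D) ^ n < c * cmod \<beta> ^ n * (cmod \<beta> ^ A0) ^ n"
          by (intro mult_less_le_imp_less) auto
        with 1 show False by simp
      qed
    qed
  qed
  with \<epsilon>(1) show ?thesis by blast
qed

section \<open>Twisted sums over words\<close>

definition wlen :: "real^'a \<Rightarrow> 'a list \<Rightarrow> real" where
  "wlen s w = (\<Sum>b\<leftarrow>w. s $ b)"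

lemma wlen_simps [simp]:
  "wlen s [] = 0" "wlen s (b # w) = s $ b + wlen s w" "wlen s (u @ v) = wlen s u + wlen s v"
  by (simp_all add: wlen_def)

text \<open>In closed form: the sum over all positions of \<open>f\<close> at the letter times
  \<open>cis (- 2 * pi * \<omega> * wlen s u)\<close>, where \<open>u\<close> is the prefix before
  the position.\<close>

primrec twisted_sum :: "real^'a \<Rightarrow> ('a \<Rightarrow> complex) \<Rightarrow> real \<Rightarrow> 'a list \<Rightarrow> complex" where
  "twisted_sum s f \<omega> [] = 0"
| "twisted_sum s f \<omega> (b # w) = f b + cis (- 2 * pi * \<omega> * (s $ b)) * twisted_sum s f \<omega> w"

lemma twisted_sum_append:
  "twisted_sum s f \<omega> (u @ v) = twisted_sum s f \<omega> u + cis (- 2 * pi * \<omega> * wlen s u) * twisted_sum s f \<omega> v"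
proof (induction u)
  case (Cons b u)
  have "cis (- 2 * pi * \<omega> * wlen s (b # u)) = cis (- 2 * pi * \<omega> * (s $ b)) * cis (- 2 * pi * \<omega> * wlen s u)"
    by (simp add: cis_mult algebra_simps)
  with Cons show ?case by (simp add: algebra_simps del: wlen_simps)
qed simp

lemma subst_word_append [simp]: "subst_word \<zeta> (u @ v) = subst_word \<zeta> u @ subst_word \<zeta> v"
  by (simp add: subst_word_def)

lemma subst_word_pow_append [simp]:
  "(subst_word \<zeta> ^^ n) (u @ v) = (subst_word \<zeta> ^^ n) u @ (subst_word \<zeta> ^^ n) v"
  by (induction n) simp_all

lemma subst_word_pow_Nil [simp]: "(subst_word \<zeta> ^^ n) [] = []"
  by (induction n) (simp_all add: subst_word_def)

lemma subst_word_pow_Cons: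
  "(subst_word \<zeta> ^^ n) (b # w) = (subst_word \<zeta> ^^ n) [b] @ (subst_word \<zeta> ^^ n) w"
  using subst_word_pow_append[of n \<zeta> "[b]" w] by simp

lemma subst_word_pow_add:
  "(subst_word \<zeta> ^^ (m + n)) w = (subst_word \<zeta> ^^ m) ((subst_word \<zeta> ^^ n) w)"
  by (simp add: funpow_add)

lemma cmod_one_plus_cis: "cmod (1 + cis (- 2 * pi * y)) = 2 * \<bar>cos (pi * y)\<bar>"
proof -
  have "1 + cis (- 2 * pi * y) = cis (- pi * y) * (cis (pi * y) + cis (- pi * y))"
    by (simp add: distrib_left cis_mult mult.assoc)
  also have "cis (pi * y) + cis (- pi * y) = of_real (2 * cos (pi * y))"
    by (simp add: complex_eq_iff)
  finally show ?thesis by (simp add: norm_mult)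
qed

lemma cos_le_of_dist_int:
  assumes "\<epsilon> \<le> dist_int y" "0 \<le> \<epsilon>"
  shows "\<bar>cos (pi * y)\<bar> \<le> cos (pi * \<epsilon>)"
proof -
  have cos_abs: "cos (pi * \<bar>d\<bar>) = cos (pi * d)" for d :: real
    by (simp add: abs_if)
  define k where "k = round y"
  define t where "t = dist_int y"
  have t: "0 \<le> t" "t \<le> 1 / 2" "\<epsilon> \<le> t"
    using of_int_round_abs_le[of y] assms by (auto simp: t_def dist_int_def abs_minus_commute)
  have "\<bar>cos (pi * y)\<bar> = \<bar>cos (pi * (y - of_int k) + of_int k * pi)\<bar>"
    by (simp add: algebra_simps)
  also have "\<dots> = \<bar>cos (pi * (y - of_int k))\<bar>"
    unfolding cos_add mult.commute[of _ pi] cos_npi_int sin_npi_int by (simp add: abs_mult)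
  also have "\<dots> = \<bar>cos (pi * t)\<bar>"
    unfolding t_def dist_int_def k_def cos_abs ..
  also have "\<dots> = cos (pi * t)"
    using t mult_left_mono[of t "1 / 2" pi]
    by (intro abs_of_nonneg cos_ge_zero order_trans[of "- (pi / 2)" 0 "pi * t"]) auto
  also have "\<dots> \<le> cos (pi * \<epsilon>)"
    using t assms by (intro cos_monotone_0_pi_le) auto
  finally show ?thesis .
qed

section \<open>Lengths and letter counts under iterated substitution\<close>

lemma wlen_eq_sum_count:
  fixes s :: "real^'a::finite"
  shows "wlen s w = (\<Sum>i\<in>UNIV. real (count_list w i) * s $ i)"
proof (induction w)
  case (Cons b w)
  have "(\<Sum>i\<in>UNIV. real (count_list (b # w) i) * s $ i)
      = (\<Sum>i\<in>UNIV. (if i = b then s $ i else 0) + real (count_list w i) * s $ i)"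
    by (intro sum.cong) (auto simp: algebra_simps)
  with Cons show ?case by (simp add: sum.distrib)
qed simp

text \<open>Coordinate \<open>b\<close> of the eigenvector equation says that
  \<open>\<zeta> b\<close> has length \<open>\<theta> * s $ b\<close>; length is additive over
  words.\<close>

lemma wlen_subst_word:
  fixes s :: "real^'a::finite"
  assumes "transpose (subst_matrix \<zeta>) *v s = \<theta> *s s"
  shows "wlen s ((subst_word \<zeta> ^^ n) w) = \<theta> ^ n * wlen s w"
proof -
  have 1: "wlen s (\<zeta> b) = \<theta> * s $ b" for b
  proof -
    have "(transpose (subst_matrix \<zeta>) *v s) $ b = \<theta> * s $ b"
      by (simp only: assms vector_smult_component)
    then show ?thesis
      by (simp del: transpose_matrix_vector add: wlen_eq_sum_count matrix_vector_mult_def transpose_def subst_matrix_def)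
  qed
  have 2: "wlen s (subst_word \<zeta> w) = \<theta> * wlen s w" for w
    by (induction w) (simp_all add: subst_word_def 1 algebra_simps)
  show ?thesis by (induction n) (simp_all add: 2)
qed

lemma count_subst_word_pow:
  fixes \<zeta> :: "'a::finite \<Rightarrow> 'a list"
  shows "real (count_list ((subst_word \<zeta> ^^ n) [j]) i) = matrix_pow (subst_matrix \<zeta>) n $ i $ j"
proof (induction n arbitrary: i)
  case 0
  then show ?case by (simp add: matrix_pow_def mat_def)
next
  case (Suc n)
  have *: "real (count_list (subst_word \<zeta> w) i) = (\<Sum>k\<in>UNIV. subst_matrix \<zeta> $ i $ k * real (count_list w k))"
    for w
  proof (induction w)
    case (Cons b w)
    have "(\<Sum>k\<in>UNIV. subst_matrix \<zeta> $ i $ k * real (count_list (b # w) k))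
      = (\<Sum>k\<in>UNIV. (if k = b then subst_matrix \<zeta> $ i $ k else 0) + subst_matrix \<zeta> $ i $ k * real (count_list w k))"
      by (intro sum.cong) (auto simp: algebra_simps)
    with Cons show ?case by (simp add: sum.distrib subst_word_def subst_matrix_def count_list_append)
  qed (simp add: subst_word_def)
  have "matrix_pow (subst_matrix \<zeta>) (Suc n) = subst_matrix \<zeta> ** matrix_pow (subst_matrix \<zeta>) n"
    by (simp add: matrix_pow_def)
  then show ?case by (simp add: * Suc matrix_matrix_mult_def)
qed

section \<open>Consequences of primitivity\<close>

lemma primitive_all_letters:
  assumes "primitive \<zeta>"
  obtains n where "\<And>i j. i \<in> set ((subst_word \<zeta> ^^ n) [j])"
proof -
  obtain n where n: "\<And>i j. 0 < matrix_pow (subst_matrix \<zeta>) n $ i $ j"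
    using assms unfolding primitive_def by blast
  have "i \<in> set ((subst_word \<zeta> ^^ n) [j])" for i j
    using n[of i j] unfolding count_subst_word_pow[symmetric]
    by (metis count_list_0_iff less_irrefl of_nat_0)
  then show ?thesis by (rule that)
qed

text \<open>With two letters available, the \<open>n\<close>-th image of \<open>c\<close> has two
  positions \<open>e\<close> and \<open>e'\<close>, and the \<open>n\<close>-th images of both
  contain \<open>c\<close>; this gives \<open>c v c\<close> at level \<open>2n\<close>. As every
  \<open>n\<close>-th image contains \<open>c\<close>, the same \<open>c v c\<close> occurs in all
  images of level \<open>3n\<close>.\<close>

lemma primitive_return_word:
  fixes \<zeta> :: "'a::finite \<Rightarrow> 'a list"
  assumes "primitive \<zeta>" "CARD('a) \<ge> 2"
  obtains c v q where "\<And>b. \<exists>w1 w2. (subst_word \<zeta> ^^ q) [b] = w1 @ c # v @ c # w2"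
proof -
  obtain n where n: "\<And>i j. i \<in> set ((subst_word \<zeta> ^^ n) [j])"
    using primitive_all_letters[OF assms(1)] by blast
  have split: "\<exists>w1 w2. (subst_word \<zeta> ^^ n) [b] = w1 @ c # w2" for b c
    using n split_list by fast
  obtain c d :: 'a where cd: "c \<noteq> d"
    using assms(2) by (metis card_2_iff' ex_card subset_UNIV)
  obtain w1 w2 where w: "(subst_word \<zeta> ^^ n) [c] = w1 @ c # w2" using split by blast
  have "d \<in> set w1 \<or> d \<in> set w2" using n[of d c] w cd by auto
  then have "\<exists>u1 e u2 e' u3. (subst_word \<zeta> ^^ n) [c] = u1 @ e # u2 @ e' # u3"
    unfolding w by (metis append.assoc append_Cons split_list)
  then obtain u1 e u2 e' u3 where u: "(subst_word \<zeta> ^^ n) [c] = u1 @ [e] @ u2 @ [e'] @ u3"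
    by auto
  obtain p1 p2 where p: "(subst_word \<zeta> ^^ n) [e] = p1 @ c # p2" using split by blast
  obtain r1 r2 where r: "(subst_word \<zeta> ^^ n) [e'] = r1 @ c # r2" using split by blast
  define v where "v = p2 @ (subst_word \<zeta> ^^ n) u2 @ r1"
  have 2: "(subst_word \<zeta> ^^ (n + n)) [c] =
      ((subst_word \<zeta> ^^ n) u1 @ p1) @ c # v @ c # (r2 @ (subst_word \<zeta> ^^ n) u3)"
    by (simp only: subst_word_pow_add u subst_word_pow_append p r v_def) simp
  show ?thesis
  proof (rule that)
    fix b
    obtain t1 t2 where "(subst_word \<zeta> ^^ n) [b] = t1 @ [c] @ t2" using split by force
    then have "(subst_word \<zeta> ^^ (n + n + n)) [b] =
        ((subst_word \<zeta> ^^ (n + n)) t1 @ (subst_word \<zeta> ^^ n) u1 @ p1) @ c # v @ c #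
        (r2 @ (subst_word \<zeta> ^^ n) u3 @ (subst_word \<zeta> ^^ (n + n)) t2)"
      by (simp only: subst_word_pow_add[of "n + n"] subst_word_pow_append 2) simp
    then show "\<exists>w1 w2. (subst_word \<zeta> ^^ (n + n + n)) [b] = w1 @ c # v @ c # w2" by blast
  qed
qed

text \<open>An iterated image of \<open>c\<close> contains \<open>c\<close> twice, so its length
  \<open>\<theta> ^ q * s $ c\<close> exceeds \<open>s $ c\<close>.\<close>

lemma primitive_dilation_gt_1:
  fixes \<zeta> :: "'a::finite \<Rightarrow> 'a list" and s :: "real^'a"
  assumes "primitive \<zeta>" "CARD('a) \<ge> 2" "\<And>j. 0 < s $ j" "0 < \<theta>"
    and eig: "transpose (subst_matrix \<zeta>) *v s = \<theta> *s s"
  shows "1 < \<theta>"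
proof -
  obtain c v q where w: "\<And>b. \<exists>w1 w2. (subst_word \<zeta> ^^ q) [b] = w1 @ c # v @ c # w2"
    using primitive_return_word[OF assms(1,2)] by metis
  obtain w1 w2 where w: "(subst_word \<zeta> ^^ q) [c] = w1 @ c # v @ c # w2" using w by blast
  have nonneg: "0 \<le> wlen s w" for w
    using assms(3) by (induction w) (auto intro: less_imp_le add_nonneg_nonneg)
  have "\<theta> ^ q * s $ c = wlen s (w1 @ c # v @ c # w2)"
    using wlen_subst_word[OF eig, of q "[c]"] by (simp add: w)
  also have "\<dots> > s $ c"
    using nonneg[of w1] nonneg[of v] nonneg[of w2] assms(3)[of c] by simp
  finally have "1 < \<theta> ^ q" using assms(3)[of c] by simp
  then show ?thesis using assms(4) power_le_one[of \<theta> q] by force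
qed

locale self_similar_suspension =
  fixes \<zeta> :: "'a::finite \<Rightarrow> 'a list" and s :: "real^'a" and \<theta> s\<^sub>m\<^sub>a\<^sub>x :: real
  assumes s_pos: "\<And>j. 0 < s $ j"
    and s_max: "\<And>j. s $ j \<le> s\<^sub>m\<^sub>a\<^sub>x"
    and eigen: "transpose (subst_matrix \<zeta>) *v s = \<theta> *s s"
    and \<theta>_gt_1: "1 < \<theta>"
begin

abbreviation zpow :: "nat \<Rightarrow> 'a list \<Rightarrow> 'a list" where
  "zpow n \<equiv> subst_word \<zeta> ^^ n"

lemma s_nonneg: "0 \<le> s $ j" and s_max_pos: "0 < s\<^sub>m\<^sub>a\<^sub>x"
  using s_pos[of j] s_pos[of undefined] s_max[of undefined] by linarith+

lemma wlen_nonneg: "0 \<le> wlen s w"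
  using s_nonneg by (induction w) auto

lemma wlen_zpow: "wlen s (zpow n w) = \<theta> ^ n * wlen s w"
  by (rule wlen_subst_word[OF eigen])

lemma wlen_sublist: "sublist u w \<Longrightarrow> wlen s u \<le> wlen s w"
  using wlen_nonneg by (auto simp: sublist_def)

end

section \<open>Normalised bounds for twisted sums over blocks\<close>

locale twisted_weights = self_similar_suspension +
  fixes f :: "'a \<Rightarrow> complex" and \<omega> :: real
  assumes f_le: "\<And>b. cmod (f b) \<le> s $ b"
begin

abbreviation "tsum \<equiv> twisted_sum s f \<omega>"

lemma norm_tsum_append_le: "cmod (tsum (u @ v)) \<le> cmod (tsum u) + cmod (tsum v)"
  unfolding twisted_sum_append
  by (rule order_trans[OF norm_triangle_ineq]) (simp add: norm_mult)

lemma norm_tsum_le: "cmod (tsum w) \<le> wlen s w"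
proof (induction w)
  case (Cons b w)
  have "cmod (tsum (b # w)) \<le> cmod (f b) + cmod (tsum w)"
    by (simp, rule order_trans[OF norm_triangle_ineq]) (simp add: norm_mult)
  with Cons f_le[of b] show ?case by simp
qed simp

text \<open>\<open>M\<close> is measured against the length \<open>\<theta> ^ n * s $ b\<close> of
  the block, so that the trivial bound is 1 and concatenation preserves \<open>M\<close>.\<close>

definition level_bound :: "nat \<Rightarrow> real \<Rightarrow> bool" where
  "level_bound n M \<longleftrightarrow> 0 \<le> M \<and> (\<forall>b. cmod (tsum (zpow n [b])) \<le> M * \<theta> ^ n * s $ b)"

lemma level_bound_word:
  assumes "level_bound n M"
  shows "cmod (tsum (zpow n w)) \<le> M * \<theta> ^ n * wlen s w"
proof (induction w)
  case (Cons b w)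
  have "cmod (tsum (zpow n (b # w))) \<le> cmod (tsum (zpow n [b])) + cmod (tsum (zpow n w))"
    by (subst subst_word_pow_Cons) (rule norm_tsum_append_le)
  also have "\<dots> \<le> M * \<theta> ^ n * s $ b + M * \<theta> ^ n * wlen s w"
    using assms Cons by (intro add_mono) (auto simp: level_bound_def)
  finally show ?case by (simp add: algebra_simps)
qed simp

lemma level_bound_0: "level_bound 0 1"
  using f_le by (simp add: level_bound_def)

lemma level_bound_mono: "level_bound n M \<Longrightarrow> M \<le> M' \<Longrightarrow> level_bound n M'"
  using \<theta>_gt_1 s_nonneg unfolding level_bound_def
  by (meson mult_right_mono order_trans zero_le_power less_imp_le zero_less_one)

text \<open>A block of level \<open>m\<close> is a concatenation of blocks of level
  \<open>n\<close>.\<close>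

lemma level_bound_le:
  assumes "level_bound n M" "n \<le> m"
  shows "level_bound m M"
proof -
  have "cmod (tsum (zpow m [b])) \<le> M * \<theta> ^ m * s $ b" for b
  proof -
    have m: "m = n + (m - n)" using assms(2) by simp
    have "cmod (tsum (zpow n (zpow (m - n) [b]))) \<le> M * \<theta> ^ n * wlen s (zpow (m - n) [b])"
      by (rule level_bound_word[OF assms(1)])
    also have "\<dots> = M * \<theta> ^ m * s $ b"
      by (subst (2) m) (simp add: wlen_zpow power_add)
    finally show ?thesis by (simp add: m[symmetric] flip: subst_word_pow_add)
  qed
  with assms(1) show ?thesis by (simp add: level_bound_def)
qed

text \<open>The two copies of \<open>c\<close> contribute with relative phase \<open>exp (-2 \<pi> i \<omega> \<theta>\<^sup>n wlen (c # v))\<close>.\<close>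

lemma level_bound_gain:
  assumes bd: "level_bound n M"
    and return: "\<And>b. \<exists>w1 w2. zpow q [b] = w1 @ c # v @ c # w2"
    and far: "\<epsilon> \<le> dist_int (\<omega> * wlen s (c # v) * \<theta> ^ n)" "0 \<le> \<epsilon>"
    and \<delta>: "\<And>b. \<delta> * \<theta> ^ q * s $ b \<le> (2 - 2 * cos (pi * \<epsilon>)) * s $ c" "\<delta> \<le> 1"
  shows "level_bound (n + q) ((1 - \<delta>) * M)"
proof -
  have M: "0 \<le> M" using bd by (simp add: level_bound_def)
  \<comment> \<open>\<open>2 - \<eta>\<close> bounds \<open>1 + cis (- 2 * pi * y)\<close>, the sum
    of the relative phases of the two \<open>c\<close>-blocks.\<close>
  define \<eta> where "\<eta> = 2 - 2 * cos (pi * \<epsilon>)"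
  define y where "y = \<omega> * wlen s (c # v) * \<theta> ^ n"
  have "cmod (tsum (zpow (n + q) [b])) \<le> (1 - \<delta>) * M * \<theta> ^ (n + q) * s $ b" for b
  proof -
    obtain w1 w2 where w: "zpow q [b] = w1 @ c # v @ c # w2" using return by blast
    have len: "wlen s w1 + 2 * s $ c + wlen s v + wlen s w2 = \<theta> ^ q * s $ b"
      using wlen_zpow[of q "[b]"] by (simp add: w)
    have split: "c # v @ c # w2 = [c] @ v @ [c] @ w2" by simp
    have ph: "cis (- 2 * pi * \<omega> * wlen s (zpow n [c])) * cis (- 2 * pi * \<omega> * wlen s (zpow n v))
        = cis (- 2 * pi * y)"
      by (simp add: cis_mult wlen_zpow y_def algebra_simps)
    define a where "a = tsum (zpow n [c])"
    define z where "z = cis (- 2 * pi * \<omega> * wlen s (zpow n [c]))"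
    have "tsum (zpow n (c # v @ c # w2))
        = a * (1 + cis (- 2 * pi * y)) + z * tsum (zpow n v)
          + cis (- 2 * pi * y) * cis (- 2 * pi * \<omega> * wlen s (zpow n [c])) * tsum (zpow n w2)"
      unfolding split subst_word_pow_append twisted_sum_append ph[symmetric]
      by (simp only: a_def z_def algebra_simps mult_1_left mult_1_right)
    also have "cmod \<dots> \<le> cmod a * (2 - \<eta>) + cmod (tsum (zpow n v)) + cmod (tsum (zpow n w2))"
    proof -
      have "cmod (1 + cis (- 2 * pi * y)) \<le> 2 - \<eta>"
        using cos_le_of_dist_int[OF far] unfolding cmod_one_plus_cis y_def[symmetric] \<eta>_def by simp
      then have "cmod (a * (1 + cis (- 2 * pi * y))) \<le> cmod a * (2 - \<eta>)"
        unfolding norm_mult by (intro mult_left_mono) auto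
      moreover have "cmod (z * tsum (zpow n v)) = cmod (tsum (zpow n v))"
        by (simp add: z_def norm_mult del: mult_eq_0_iff)
      ultimately show ?thesis
        by (intro norm_triangle_le add_mono) (auto simp: norm_mult z_def)
    qed
    finally have "cmod (tsum (zpow n (zpow q [b]))) \<le> cmod (tsum (zpow n w1)) + (cmod a * (2 - \<eta>)
        + cmod (tsum (zpow n v)) + cmod (tsum (zpow n w2)))"
      unfolding w subst_word_pow_append[of n \<zeta> w1]
      by (intro order_trans[OF norm_tsum_append_le]) simp
    also have "\<dots> \<le> M * \<theta> ^ n * wlen s w1 + (M * \<theta> ^ n * s $ c * (2 - \<eta>)
        + M * \<theta> ^ n * wlen s v + M * \<theta> ^ n * wlen s w2)"
      using level_bound_word[OF bd, of "[c]"] cos_le_one[of "pi * \<epsilon>"] cos_ge_minus_one[of "pi * \<epsilon>"]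
        cos_le_of_dist_int[OF far]
      by (intro add_mono level_bound_word[OF bd] mult_right_mono) (auto simp: a_def \<eta>_def)
    also have "\<dots> = M * \<theta> ^ n * (\<theta> ^ q * s $ b - \<eta> * s $ c)"
      unfolding len[symmetric] by (simp add: algebra_simps)
    \<comment> \<open>The hypothesis on \<open>\<delta>\<close> turns the loss at the letter
      \<open>c\<close> into a fixed proportion of the length of the whole block.\<close>
    also have "\<dots> \<le> M * \<theta> ^ n * (\<theta> ^ q * s $ b - \<delta> * \<theta> ^ q * s $ b)"
      using \<delta>(1)[of b] M \<theta>_gt_1 by (intro mult_left_mono) (auto simp: \<eta>_def)
    finally show ?thesis by (simp add: subst_word_pow_add algebra_simps power_add)
  qed
  then show ?thesis using M \<delta>(2) by (simp add: level_bound_def)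
qed

text \<open>Only the last block can be incomplete; it is bounded by its length.\<close>

lemma norm_tsum_prefix_le:
  assumes bd: "level_bound n M" and "prefix u (zpow n w)"
  shows "cmod (tsum u) \<le> M * wlen s u + \<theta> ^ n * s\<^sub>m\<^sub>a\<^sub>x"
  using assms(2)
proof (induction w arbitrary: u)
  case Nil
  then show ?case using s_max_pos \<theta>_gt_1 by simp
next
  case (Cons b w)
  have M: "0 \<le> M" using bd by (simp add: level_bound_def)
  from Cons.prems consider "prefix u (zpow n [b])"
    | u' where "u = zpow n [b] @ u'" "prefix u' (zpow n w)"
    by (subst (asm) subst_word_pow_Cons) (auto simp: prefix_append)
  then show ?case
  proof cases
    case 1
    have "wlen s u \<le> \<theta> ^ n * s $ b"
      using wlen_sublist[OF prefix_imp_sublist[OF 1]] by (simp add: wlen_zpow)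
    also have "\<dots> \<le> \<theta> ^ n * s\<^sub>m\<^sub>a\<^sub>x"
      using s_max \<theta>_gt_1 by (intro mult_left_mono) auto
    finally show ?thesis using norm_tsum_le[of u] mult_nonneg_nonneg[OF M wlen_nonneg[of u]] by linarith
  next
    case 2
    have "cmod (tsum u) \<le> cmod (tsum (zpow n [b])) + cmod (tsum u')"
      unfolding 2 by (rule norm_tsum_append_le)
    also have "\<dots> \<le> M * \<theta> ^ n * wlen s [b] + (M * wlen s u' + \<theta> ^ n * s\<^sub>m\<^sub>a\<^sub>x)"
      using Cons.IH[OF 2(2)] level_bound_word[OF bd, of "[b]"] by linarith
    finally show ?thesis by (simp add: 2 wlen_zpow algebra_simps)
  qed
qed

text \<open>Compared with a prefix, a factor can have a second cut block at its left end, hence the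
  2.\<close>

lemma norm_tsum_sublist_le:
  assumes bd: "level_bound n M" and "sublist u (zpow n w)"
  shows "cmod (tsum u) \<le> M * wlen s u + 2 * \<theta> ^ n * s\<^sub>m\<^sub>a\<^sub>x"
  using assms(2)
proof (induction w)
  case Nil
  then show ?case using s_max_pos \<theta>_gt_1 by simp
next
  case (Cons b w)
  have M: "0 \<le> M" using bd by (simp add: level_bound_def)
  have block: "cmod (tsum v) \<le> \<theta> ^ n * s\<^sub>m\<^sub>a\<^sub>x" if "sublist v (zpow n [b])" for v
  proof -
    have "wlen s v \<le> \<theta> ^ n * s $ b"
      using wlen_sublist[OF that] by (simp add: wlen_zpow)
    also have "\<dots> \<le> \<theta> ^ n * s\<^sub>m\<^sub>a\<^sub>x"
      using s_max \<theta>_gt_1 by (intro mult_left_mono) auto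
    finally show ?thesis using norm_tsum_le[of v] by linarith
  qed
  have pos: "0 \<le> \<theta> ^ n * s\<^sub>m\<^sub>a\<^sub>x" "0 \<le> M * wlen s v" for v
    using s_max_pos \<theta>_gt_1 M wlen_nonneg by auto
  from Cons.prems consider "sublist u (zpow n [b])" | "sublist u (zpow n w)"
    | u1 u2 where "u = u1 @ u2" "suffix u1 (zpow n [b])" "prefix u2 (zpow n w)"
    by (subst (asm) subst_word_pow_Cons) (auto simp: sublist_append)
  then show ?case
  proof cases
    case 1
    then show ?thesis using block[OF 1] pos(1) pos(2)[of u] by linarith
  next
    case 2
    then show ?thesis by (rule Cons.IH)
  next
    case 3
    have "cmod (tsum u) \<le> cmod (tsum u1) + cmod (tsum u2)"
      unfolding 3 by (rule norm_tsum_append_le)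
    also have "\<dots> \<le> \<theta> ^ n * s\<^sub>m\<^sub>a\<^sub>x + (M * wlen s u2 + \<theta> ^ n * s\<^sub>m\<^sub>a\<^sub>x)"
      using block[OF suffix_imp_sublist[OF 3(2)]] norm_tsum_prefix_le[OF bd 3(3)] by linarith
    finally show ?thesis using pos(2)[of u1] by (simp add: 3 algebra_simps)
  qed
qed

lemma norm_tsum_subword_le:
  assumes bd: "level_bound n M" and x: "x \<in> subst_space \<zeta>"
  shows "cmod (tsum (subword x i N)) \<le> M * wlen s (subword x i N) + 2 * \<theta> ^ n * s\<^sub>m\<^sub>a\<^sub>x"
proof -
  obtain a k where k: "sublist (subword x i N) (zpow k [a])"
    using x unfolding subst_space_def by blast
  show ?thesis
  proof (cases "n \<le> k")
    case True
    then have "zpow k [a] = zpow n (zpow (k - n) [a])" by (simp flip: subst_word_pow_add)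
    with k show ?thesis by (intro norm_tsum_sublist_le[OF bd]) auto
  next
    \<comment> \<open>Here the whole word \<open>zpow k [a]\<close> has length at most
      \<open>\<theta> ^ n * s\<^sub>m\<^sub>a\<^sub>x\<close>, so the trivial bound
      suffices.\<close>
    case False
    have "wlen s (subword x i N) \<le> \<theta> ^ k * s $ a"
      using wlen_sublist[OF k] by (simp add: wlen_zpow)
    also have "\<dots> \<le> \<theta> ^ n * s\<^sub>m\<^sub>a\<^sub>x"
      using s_max s_nonneg \<theta>_gt_1 False by (intro mult_mono power_increasing) auto
    finally have "cmod (tsum (subword x i N)) \<le> \<theta> ^ n * s\<^sub>m\<^sub>a\<^sub>x"
      using norm_tsum_le[of "subword x i N"] by linarith
    moreover have "0 \<le> M * wlen s (subword x i N)" "0 \<le> \<theta> ^ n * s\<^sub>m\<^sub>a\<^sub>x"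
      using bd wlen_nonneg s_max_pos \<theta>_gt_1 by (auto simp: level_bound_def)
    ultimately show ?thesis by linarith
  qed
qed

end

section \<open>Iterating the drops\<close>

context self_similar_suspension
begin

text \<open>Passing from a large level \<open>m\<close> to \<open>A' * m\<close> gains a factor
  \<open>1 - \<delta>\<close>, so level \<open>n\<close> has seen about \<open>log A' n\<close>
  drops, and \<open>(1 - \<delta>) powr log A' n\<close> is
  \<open>n powr (- \<gamma>)\<close>.\<close>

lemma level_bound_decay:
  assumes prim: "primitive \<zeta>" "CARD('a) \<ge> 2"
    and near: "\<exists>\<epsilon>>0. \<exists>A. \<forall>B>0. \<exists>n\<^sub>0. \<forall>n\<ge>n\<^sub>0. \<forall>y. 1 / B \<le> \<bar>y\<bar> \<longrightarrow> \<bar>y\<bar> \<le> B \<longrightarrow>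
      (\<exists>k\<in>{n..A * n}. \<epsilon> \<le> dist_int (y * \<theta> ^ k))"
  shows "\<exists>\<gamma>>0. \<forall>B>1. \<exists>C>0. \<exists>n\<^sub>0>0. \<forall>\<omega> f n. 1 / B \<le> \<bar>\<omega>\<bar> \<longrightarrow> \<bar>\<omega>\<bar> \<le> B \<longrightarrow>
    (\<forall>b. cmod (f b) \<le> s $ b) \<longrightarrow> n\<^sub>0 \<le> n \<longrightarrow>
    twisted_weights.level_bound \<zeta> s \<theta> f \<omega> n (C * real n powr (- \<gamma>))"
proof -
  obtain c v q where return: "\<And>b. \<exists>w1 w2. zpow q [b] = w1 @ c # v @ c # w2"
    using primitive_return_word[OF prim] by metis
  obtain \<epsilon>' A where \<epsilon>': "\<epsilon>' > 0" and near': "\<And>B. B > 0 \<Longrightarrow> \<exists>n\<^sub>0. \<forall>n\<ge>n\<^sub>0. \<forall>y. 1 / B \<le> \<bar>y\<bar> \<longrightarrow> \<bar>y\<bar> \<le> B \<longrightarrow>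
      (\<exists>k\<in>{n..A * n}. \<epsilon>' \<le> dist_int (y * \<theta> ^ k))"
    using near by blast
  \<comment> \<open>The cap keeps \<open>pi * \<epsilon>\<close> in the interval from 0 to
    \<open>pi\<close>, where the cosine decreases strictly.\<close>
  define \<epsilon> where "\<epsilon> = min \<epsilon>' (1 / 2)"
  have \<epsilon>: "0 < \<epsilon>" "\<epsilon> \<le> 1 / 2" "\<epsilon> \<le> \<epsilon>'" using \<epsilon>' by (auto simp: \<epsilon>_def)
  define l where "l = wlen s (c # v)"
  have l: "l > 0" using s_pos[of c] wlen_nonneg[of v] by (simp add: l_def)
  define \<eta> where "\<eta> = 2 - 2 * cos (pi * \<epsilon>)"
  have \<eta>: "\<eta> > 0"
  proof -
    have "cos (pi * \<epsilon>) < cos 0" using \<epsilon> by (intro cos_monotone_0_pi) auto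
    then show ?thesis by (simp add: \<eta>_def)
  qed
  \<comment> \<open>The first entry yields the hypothesis of \<open>level_bound_gain\<close> for
    every letter \<open>b\<close>; the second keeps \<open>1 - \<delta>\<close> positive.\<close>
  define \<delta> where "\<delta> = min (\<eta> * s $ c / (\<theta> ^ q * s\<^sub>m\<^sub>a\<^sub>x)) (1 / 2)"
  have \<theta>0: "0 < \<theta> ^ k" for k using \<theta>_gt_1 by simp
  have \<delta>: "0 < \<delta>" "\<delta> \<le> 1 / 2"
    using \<eta> s_pos s_max_pos \<theta>0 unfolding \<delta>_def by (simp, intro min.cobounded2)
  have \<delta>_le: "\<delta> * \<theta> ^ q * s $ b \<le> \<eta> * s $ c" for b
  proof -
    have "\<delta> * (\<theta> ^ q * s $ b) \<le> \<eta> * s $ c / (\<theta> ^ q * s\<^sub>m\<^sub>a\<^sub>x) * (\<theta> ^ q * s\<^sub>m\<^sub>a\<^sub>x)"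
      using \<eta> s_nonneg s_max s_max_pos \<theta>0[of q] \<delta>
      by (intro mult_mono mult_left_mono) (auto simp: \<delta>_def intro!: mult_nonneg_nonneg divide_nonneg_nonneg)
    moreover have "\<theta> ^ q * s\<^sub>m\<^sub>a\<^sub>x \<noteq> 0"
      using mult_pos_pos[OF \<theta>0[of q] s_max_pos] by (metis less_irrefl)
    ultimately show ?thesis by (metis mult.assoc nonzero_divide_eq_eq)
  qed
  \<comment> \<open>A drop that starts at a level up to \<open>A * m\<close> is complete
    \<open>q\<close> levels later, and \<open>q \<le> q * m\<close>; the summand 2 ensures
    \<open>A' > 1\<close>.\<close>
  define A' where "A' = A + q + 2"
  have A': "real A' > 1" by (simp add: A'_def)
  define \<gamma> where "\<gamma> = - log A' (1 - \<delta>)"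
  have \<gamma>: "\<gamma> > 0" using \<delta> A' by (simp add: \<gamma>_def log_less_zero_cancel_iff)
  show ?thesis
  proof (rule exI[of _ \<gamma>], intro conjI allI impI \<gamma>)
    fix B :: real assume B: "B > 1"
    \<comment> \<open>The number to be tested is \<open>\<omega> * l\<close>; its modulus lies
      between \<open>1 / B1\<close> and \<open>B1\<close> if that of \<open>\<omega>\<close> lies
      between \<open>1 / B\<close> and \<open>B\<close>.\<close>
    define B1 where "B1 = max (B * l) (B / l)"
    have B1: "B1 > 0" using B l by (simp add: B1_def less_max_iff_disj)
    obtain n0 where n0: "\<And>n y. n0 \<le> n \<Longrightarrow> 1 / B1 \<le> \<bar>y\<bar> \<Longrightarrow> \<bar>y\<bar> \<le> B1 \<Longrightarrow>
      \<exists>k\<in>{n..A * n}. \<epsilon>' \<le> dist_int (y * \<theta> ^ k)"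
      using near'[OF B1] by blast
    define n1 where "n1 = max n0 1"
    have n1: "n1 \<ge> 1" "n0 \<le> n1" by (auto simp: n1_def)
    \<comment> \<open>\<open>n1 powr \<gamma>\<close> appears because drops are counted by
      \<open>n / n1\<close>; dividing by \<open>1 - \<delta>\<close> pays for rounding their number
      down.\<close>
    define C where "C = real n1 powr \<gamma> / (1 - \<delta>)"
    have C: "C > 0" using n1 \<delta> by (simp add: C_def)
    show "\<exists>C>0. \<exists>n\<^sub>0>0. \<forall>\<omega> f n. 1 / B \<le> \<bar>\<omega>\<bar> \<longrightarrow> \<bar>\<omega>\<bar> \<le> B \<longrightarrow>
      (\<forall>b. cmod (f b) \<le> s $ b) \<longrightarrow> n\<^sub>0 \<le> n \<longrightarrow>
      twisted_weights.level_bound \<zeta> s \<theta> f \<omega> n (C * real n powr (- \<gamma>))"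
    proof (rule exI[of _ C], intro conjI C, rule exI[of _ n1], intro conjI allI impI)
      show "0 < n1" using n1 by simp
    next
      fix \<omega> f n
      assume \<omega>: "1 / B \<le> \<bar>\<omega>\<bar>" "\<bar>\<omega>\<bar> \<le> B" and f: "\<forall>b. cmod (f b) \<le> s $ b" and n: "n1 \<le> n"
      interpret twisted_weights \<zeta> s \<theta> s\<^sub>m\<^sub>a\<^sub>x f \<omega>
        by unfold_locales (use f in auto)
      have y: "1 / B1 \<le> \<bar>\<omega> * l\<bar>" "\<bar>\<omega> * l\<bar> \<le> B1"
      proof -
        have "1 / B1 \<le> 1 / (B / l)" using B l by (intro divide_left_mono) (auto simp: B1_def less_max_iff_disj)
        also have "\<dots> = 1 / B * l" using B l by simp
        also have "\<dots> \<le> \<bar>\<omega>\<bar> * l" using \<omega> l by (intro mult_right_mono) auto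
        finally show "1 / B1 \<le> \<bar>\<omega> * l\<bar>" using l by (simp add: abs_mult)
        have "\<bar>\<omega>\<bar> * l \<le> B * l" using \<omega> l by (intro mult_right_mono) auto
        then show "\<bar>\<omega> * l\<bar> \<le> B1" using l by (simp add: abs_mult B1_def le_max_iff_disj)
      qed
      have iter: "level_bound (n1 * A' ^ i) ((1 - \<delta>) ^ i)" for i
      proof (induction i)
        case 0
        then show ?case using level_bound_le[OF level_bound_0, of n1] by simp
      next
        case (Suc i)
        define m where "m = n1 * A' ^ i"
        have m: "n1 \<le> m" using A' by (simp add: m_def)
        then obtain k where k: "m \<le> k" "k \<le> A * m" "\<epsilon>' \<le> dist_int (\<omega> * l * \<theta> ^ k)"
          using n0[of m "\<omega> * l"] y n1 by auto
        have "level_bound (k + q) ((1 - \<delta>) * (1 - \<delta>) ^ i)"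
          using Suc k \<epsilon> \<delta> \<delta>_le
          by (intro level_bound_gain[OF _ return, where \<epsilon> = \<epsilon>] level_bound_le[of m _ k])
            (auto simp: m_def l_def \<eta>_def)
        moreover have "k + q \<le> n1 * A' ^ Suc i"
        proof -
          have "q \<le> q * m" using m n1 by simp
          then have "k + q \<le> A * m + q * m" using k by linarith
          also have "\<dots> \<le> A' * m" by (simp add: A'_def algebra_simps)
          finally show ?thesis by (simp add: m_def algebra_simps)
        qed
        ultimately show ?case using level_bound_le by simp
      qed
      define z where "z = real n / real n1"
      have z: "z \<ge> 1" using n n1 by (simp add: z_def)
      define i where "i = nat \<lfloor>log A' z\<rfloor>"
      have "0 \<le> log A' z" using z A' by simp
      then have i: "real i \<le> log A' z" "log A' z - 1 \<le> real i"
        unfolding i_def by linarith+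
      have "real A' ^ i \<le> z"
      proof -
        have "real A' ^ i = real A' powr real i" using A' by (simp add: powr_realpow)
        also have "\<dots> \<le> real A' powr log A' z" using i A' by (intro powr_mono) auto
        also have "\<dots> = z" using A' z by (intro powr_log_cancel) auto
        finally show ?thesis .
      qed
      then have "real (n1 * A' ^ i) \<le> real n" using n1 by (simp add: z_def field_simps)
      then have "level_bound n ((1 - \<delta>) ^ i)" by (intro level_bound_le[OF iter]) linarith
      moreover have "(1 - \<delta>) ^ i \<le> C * real n powr (- \<gamma>)"
      proof -
        have "(1 - \<delta>) ^ i = (1 - \<delta>) powr real i" using \<delta> by (simp add: powr_realpow)
        also have "\<dots> \<le> (1 - \<delta>) powr (log A' z - 1)" using i \<delta> by (intro powr_mono') auto
        also have "\<dots> = (1 - \<delta>) powr (log A' z) / (1 - \<delta>)" using \<delta> by (simp add: powr_diff)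
        also have "(1 - \<delta>) powr (log A' z) = z powr (- \<gamma>)"
          using \<delta> z A' by (simp add: powr_def \<gamma>_def log_def)
        also have "z powr (- \<gamma>) = real n1 powr \<gamma> * real n powr (- \<gamma>)"
          using n n1 by (simp add: z_def powr_divide powr_minus field_simps)
        finally show ?thesis by (simp add: C_def)
      qed
      ultimately show "level_bound n (C * real n powr (- \<gamma>))" by (rule level_bound_mono)
    qed
  qed
qed

end

section \<open>The suspension flow\<close>

lemma height_nat: "height s x (int N) = wlen s (subword x 0 N)"
proof (induction N)
  case (Suc N)
  have "height s x (int (Suc N)) = height s x (int N) + s $ x (int N)"
    using height_Suc[of s x "int N"] by (simp add: add.commute)
  moreover have "subword x 0 (Suc N) = subword x 0 N @ [x (int N)]"
    by (simp add: subword_def)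
  ultimately show ?case by (simp add: Suc)
qed (simp add: subword_def)

text \<open>The cocycle identity, from which the flow law follows; the induction runs from 0 in both
  directions.\<close>

lemma height_shift: "height s (shift n x) m = height s x (n + m) - height s x n"
proof (induction m rule: int_induct[where k = 0])
  case (step1 i)
  have "height s x (n + (i + 1)) = height s x (n + i) + s $ x (n + i)"
    using height_Suc[of s x "n + i"] by (simp only: add.assoc)
  then show ?case
    using height_Suc[of s "shift n x" i] step1(2)
    by (simp only: shift_def add.commute[of i n])
next
  case (step2 i)
  have "height s x (n + i) = height s x (n + (i - 1)) + s $ x (n + (i - 1))"
    using height_Suc[of s x "n + (i - 1)"] by (simp only: add.assoc diff_add_cancel)
  then show ?case
    using height_Suc[of s "shift n x" "i - 1"] step2(2)
    by (simp only: shift_def add.commute[of "i - 1" n] diff_add_cancel)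
qed simp

lemma shift_shift: "shift m (shift n x) = shift (n + m) x"
  by (simp add: shift_def ac_simps)

lemma shift_apply: "shift n x k = x (k + n)"
  by (simp add: shift_def)

lemma shift_0 [simp]: "shift 0 x = x"
  by (simp add: shift_def)

lemma shift_subst_space: "x \<in> subst_space \<zeta> \<Longrightarrow> shift n x \<in> subst_space \<zeta>"
proof -
  have "subword (shift n x) i N = subword x (i + n) N" for i N
    unfolding subword_def shift_def by (simp add: algebra_simps)
  then show "x \<in> subst_space \<zeta> \<Longrightarrow> shift n x \<in> subst_space \<zeta>"
    unfolding subst_space_def by auto
qed

text \<open>The second disjunct accounts for the top edge \<open>t = s $ a\<close> of the closed box over \<open>[a]\<close>, which
  \<^const>\<open>susp_cylinder\<close> identifies with points of height \<open>0\<close>.\<close>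

definition in_tile :: "real^'a \<Rightarrow> 'a \<Rightarrow> (int \<Rightarrow> 'a) \<Rightarrow> real \<Rightarrow> bool" where
  "in_tile s a x v \<longleftrightarrow> (\<exists>n. height s x n \<le> v \<and> v < height s x (n + 1) \<and>
     (x n = a \<or> v = height s x n \<and> x (n - 1) = a))"

locale positive_roof =
  fixes s :: "real^'a::finite"
  assumes roof_pos: "\<And>j. 0 < s $ j"
begin

lemma susp_flow_eq:
  assumes "height s x n \<le> u + t" "u + t < height s x (n + 1)"
  shows "susp_flow s t (x, u) = (shift n x, u + t - height s x n)"
proof -
  have "(THE n. height s x n \<le> u + t \<and> u + t < height s x (n + 1)) = n"
    using assms height_ex1[OF roof_pos, of x "u + t"] by (intro the1_equality) auto
  then show ?thesis by (simp add: susp_flow_def)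
qed

text \<open>By the cocycle identity the index \<open>n + m\<close> satisfies the inequalities that
  define the flow at time \<open>t + t'\<close>, and these determine the index.\<close>

lemma susp_flow_add: "susp_flow s t (susp_flow s t' p) = susp_flow s (t + t') p"
proof (cases p)
  case (Pair x u)
  obtain n where n: "height s x n \<le> u + t'" "u + t' < height s x (n + 1)"
    using height_ex1[OF roof_pos, of x "u + t'"] by blast
  define y where "y = shift n x"
  define w where "w = u + t' - height s x n"
  obtain m where m: "height s y m \<le> w + t" "w + t < height s y (m + 1)"
    using height_ex1[OF roof_pos, of y "w + t"] by blast
  have "height s x (n + m) \<le> u + (t + t')" "u + (t + t') < height s x (n + m + 1)"
    using m by (simp_all add: y_def w_def height_shift algebra_simps)
  note flow = susp_flow_eq[OF this]
  have "susp_flow s t (susp_flow s t' p) = (shift m y, w + t - height s y m)"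
    by (simp only: Pair susp_flow_eq[OF n] flip: y_def w_def) (rule susp_flow_eq[OF m])
  also have "\<dots> = susp_flow s (t + t') p"
    unfolding Pair flow by (simp add: y_def w_def shift_shift height_shift)
  finally show ?thesis .
qed

lemma susp_spaceD:
  assumes "(x, u) \<in> susp_space \<zeta> s"
  shows "x \<in> subst_space \<zeta>" "0 \<le> u" "u < s $ x 0"
  using assms shift_subst_space[of _ \<zeta> 1] roof_pos
  by (auto simp: susp_space_def closed_boxes_def susp_proj_def split: if_splits)

lemma susp_cylinder_iff:
  "(y, t) \<in> susp_cylinder \<zeta> s a \<longleftrightarrow> y \<in> subst_space \<zeta> \<and>
     (y 0 = a \<and> 0 \<le> t \<and> t < s $ a \<or> t = 0 \<and> y (- 1) = a)"
proof
  assume "(y, t) \<in> susp_cylinder \<zeta> s a"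
  then show "y \<in> subst_space \<zeta> \<and> (y 0 = a \<and> 0 \<le> t \<and> t < s $ a \<or> t = 0 \<and> y (- 1) = a)"
    using shift_subst_space[of _ \<zeta> 1]
    by (auto simp: susp_cylinder_def closed_boxes_def susp_proj_def shift_apply split: if_splits)
next
  assume y: "y \<in> subst_space \<zeta> \<and> (y 0 = a \<and> 0 \<le> t \<and> t < s $ a \<or> t = 0 \<and> y (- 1) = a)"
  then consider "y 0 = a" "0 \<le> t" "t < s $ a" | "t = 0" "y (- 1) = a" by blast
  then show "(y, t) \<in> susp_cylinder \<zeta> s a"
  proof cases
    case 1
    then show ?thesis using y unfolding susp_cylinder_def
      by (intro image_eqI[of _ _ "(y, t)"]) (auto simp: closed_boxes_def susp_proj_def)
  next
    case 2
    \<comment> \<open>A point of height 0 with letter \<open>a\<close> at position -1 is the image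
      of the top edge over the previous base point.\<close>
    have "(shift (- 1) y, s $ a) \<in> {(x, t) \<in> closed_boxes \<zeta> s. x 0 = a}"
      using y 2 roof_pos[of a] shift_subst_space[of y \<zeta> "-1"]
      by (simp add: closed_boxes_def shift_apply)
    moreover have "(y, t) = susp_proj s (shift (- 1) y, s $ a)"
      using 2 by (simp add: susp_proj_def shift_apply shift_shift)
    ultimately show ?thesis unfolding susp_cylinder_def by (rule rev_image_eqI)
  qed
qed

text \<open>Turns a visit to the cylinder into a condition on heights, which can be integrated tile
  by tile and is easily seen to be measurable.\<close>

lemma susp_flow_in_cylinder_iff:
  assumes "(x, u) \<in> susp_space \<zeta> s"
  shows "susp_flow s t (x, u) \<in> susp_cylinder \<zeta> s a \<longleftrightarrow> in_tile s a x (u + t)"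
proof -
  obtain n where n: "height s x n \<le> u + t" "u + t < height s x (n + 1)"
    and uniq: "\<And>k. height s x k \<le> u + t \<and> u + t < height s x (k + 1) \<Longrightarrow> k = n"
    using height_ex1[OF roof_pos, of x "u + t"] by blast
  have "in_tile s a x (u + t) \<longleftrightarrow> x n = a \<or> u + t = height s x n \<and> x (n - 1) = a"
    using n uniq unfolding in_tile_def by blast
  moreover have "shift n x \<in> subst_space \<zeta>"
    using susp_spaceD(1)[OF assms] by (rule shift_subst_space)
  ultimately show ?thesis
    using n height_Suc[of s x n] unfolding susp_flow_eq[OF n] susp_cylinder_iff
    by (auto simp: shift_def)
qed

end

section \<open>Measurability of tile membership and of cylinders\<close>

lemma measurable_height [measurable]:
  fixes s :: "real^'a::finite"
  shows "(\<lambda>x. height s x n) \<in> borel_measurable (PiM UNIV (\<lambda>_. count_space UNIV))"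
proof -
  have [measurable]: "(\<lambda>x. s $ (x k)) \<in> borel_measurable (PiM UNIV (\<lambda>_. count_space UNIV))" for k :: int
    by (rule measurable_compose[OF measurable_component_singleton]) auto
  show ?thesis unfolding height_def by measurable
qed

lemma measurable_letter_eq [measurable]:
  "Measurable.pred (PiM UNIV (\<lambda>_. count_space UNIV)) (\<lambda>x. x (k::int) = a)"
proof -
  have "(\<lambda>x. x k) \<in> measurable (PiM UNIV (\<lambda>_. count_space UNIV)) (count_space UNIV)"
    by (rule measurable_component_singleton) auto
  then show ?thesis by (rule measurable_compose) auto
qed

text \<open>\<open>in_tile\<close> is a countable union over \<open>n\<close> of conditions on
  heights, which avoids the definite description in \<open>susp_flow\<close>. Measurability jointly
  in time and point is what Fubini requires.\<close>

lemma measurable_in_tile: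
  fixes s :: "real^'a::finite"
  assumes "sets \<mu> = sets (susp_algebra \<zeta> s)"
  shows "Measurable.pred (borel \<Otimes>\<^sub>M \<mu>) (\<lambda>(t, p). in_tile s a (fst p) (snd p + t))"
proof -
  have "(\<lambda>p. p) \<in> measurable (susp_algebra \<zeta> s) (PiM UNIV (\<lambda>_. count_space UNIV) \<Otimes>\<^sub>M borel)"
    unfolding susp_algebra_def by (rule measurable_restrict_space1) simp
  then have [measurable]: "(\<lambda>p. p) \<in> measurable \<mu> (PiM UNIV (\<lambda>_. count_space UNIV) \<Otimes>\<^sub>M borel)"
    using assms by (simp cong: measurable_cong_sets)
  have [measurable]: "fst \<in> measurable \<mu> (PiM UNIV (\<lambda>_. count_space UNIV))"
    "snd \<in> borel_measurable \<mu>"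
    using measurable_compose[OF _ measurable_fst] measurable_compose[OF _ measurable_snd]
    by measurable
  show ?thesis unfolding in_tile_def split_beta by measurable
qed

lemma susp_cylinder_sets:
  fixes s :: "real^'a::finite"
  assumes "sets \<mu> = sets (susp_algebra \<zeta> s)" and pos: "\<And>j. 0 < s $ j"
  shows "susp_cylinder \<zeta> s a \<in> sets \<mu>"
proof -
  interpret positive_roof s by unfold_locales (rule pos)
  define S where "S = {p \<in> space (PiM UNIV (\<lambda>_. count_space UNIV) \<Otimes>\<^sub>M borel).
    (fst p (0::int) = a \<and> 0 \<le> snd p \<and> snd p < s $ a \<or> snd p = (0::real) \<and> fst p (- 1) = a)}"
  have S: "S \<in> sets (PiM UNIV (\<lambda>_. count_space UNIV) \<Otimes>\<^sub>M borel)"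
    unfolding S_def by measurable
  have "susp_cylinder \<zeta> s a \<subseteq> susp_space \<zeta> s"
    unfolding susp_cylinder_def susp_space_def by auto
  then have "susp_cylinder \<zeta> s a = susp_space \<zeta> s \<inter> S"
    using susp_spaceD(1)
    by (auto simp: S_def susp_cylinder_iff space_pair_measure space_PiM)
  then show ?thesis
    unfolding assms susp_algebra_def sets_restrict_space using S by auto
qed

lemma space_susp_algebra: "space (susp_algebra \<zeta> s) = susp_space \<zeta> s"
  by (simp add: susp_algebra_def space_restrict_space space_pair_measure space_PiM)

section \<open>Twisted orbit integrals\<close>

text \<open>Chosen so that twisted sums become Fourier integrals of the cylinder indicator along
  orbits.\<close>

definition tile_weight :: "real^'a \<Rightarrow> real \<Rightarrow> 'a \<Rightarrow> 'a \<Rightarrow> complex" where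
  "tile_weight s \<omega> a b = (if b = a then integral {0..s $ b} (\<lambda>t. cis (- 2 * pi * \<omega> * t)) else 0)"

context positive_roof
begin

lemma in_tile_interior:
  assumes "height s x n < v" "v < height s x (n + 1)"
  shows "in_tile s a x v \<longleftrightarrow> x n = a"
proof -
  have "k = n" if "height s x k \<le> v \<and> v < height s x (k + 1)" for k
  proof -
    obtain m where "\<And>k. height s x k \<le> v \<and> v < height s x (k + 1) \<Longrightarrow> k = m"
      using height_ex1[OF roof_pos, of x v] by blast
    from this[of k] this[of n] that assms show ?thesis by simp
  qed
  then show ?thesis using assms unfolding in_tile_def by (auto intro: less_imp_le)
qed

lemma norm_tile_weight_le: "cmod (tile_weight s \<omega> a b) \<le> s $ b"
proof -
  have "norm (integral {0..s $ b} (\<lambda>t. cis (- 2 * pi * \<omega> * t))) \<le> 1 * (s $ b - 0)"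
    using roof_pos[of b] by (intro integral_bound continuous_intros) auto
  then show ?thesis using roof_pos[of b] by (auto simp: tile_weight_def)
qed

text \<open>One more letter appends one tile. Its integral is the one from 0 to \<open>s $ b\<close>
  translated by the height \<open>H\<close>, and the translation produces the phase in
  \<open>twisted_sum\<close>.\<close>

lemma has_integral_tiles:
  "((\<lambda>v. cis (- 2 * pi * \<omega> * v) * of_bool (in_tile s a x v)) has_integral
     twisted_sum s (tile_weight s \<omega> a) \<omega> (subword x 0 N)) {0..height s x (int N)}"
proof (induction N)
  case 0
  then show ?case by (simp add: subword_def has_integral_refl)
next
  case (Suc N)
  define H where "H = height s x (int N)"
  define b where "b = x (int N)"
  define I where "I = integral {0..s $ b} (\<lambda>t. cis (- 2 * pi * \<omega> * t))"
  have H: "0 \<le> H" by (simp add: H_def height_def sum_nonneg less_imp_le[OF roof_pos])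
  have H': "height s x (int (Suc N)) = H + s $ b" "height s x (int N + 1) = H + s $ b"
    using height_Suc[of s x "int N"] by (simp_all add: H_def b_def add.commute)
  have "((\<lambda>t. cis (- 2 * pi * \<omega> * t)) has_integral I) {0..s $ b}"
    unfolding I_def by (intro integrable_integral integrable_continuous_interval continuous_intros)
  then have "((\<lambda>t. cis (- 2 * pi * \<omega> * (t + - H))) has_integral I) {0 - - H..s $ b - - H}"
    by (rule has_integral_shift_real_ivl)
  then have "((\<lambda>t. of_bool (b = a) * cis (- 2 * pi * \<omega> * H) * cis (- 2 * pi * \<omega> * (t + - H))) has_integral
      of_bool (b = a) * cis (- 2 * pi * \<omega> * H) * I) {0 - - H..s $ b - - H}"
    by (rule has_integral_mult_right)
  also have "(\<lambda>t. of_bool (b = a) * cis (- 2 * pi * \<omega> * H) * cis (- 2 * pi * \<omega> * (t + - H)))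
      = (\<lambda>t. cis (- 2 * pi * \<omega> * t) * of_bool (b = a))"
    by (simp add: fun_eq_iff cis_mult mult.assoc) (simp add: algebra_simps)
  also have "of_bool (b = a) * cis (- 2 * pi * \<omega> * H) * I = cis (- 2 * pi * \<omega> * H) * tile_weight s \<omega> a b"
    by (simp add: tile_weight_def I_def)
  also have "{0 - - H..s $ b - - H} = {H..H + s $ b}" by (simp add: add.commute)
  finally have "((\<lambda>v. cis (- 2 * pi * \<omega> * v) * of_bool (b = a)) has_integral
      cis (- 2 * pi * \<omega> * H) * tile_weight s \<omega> a b) {H..H + s $ b}" .
  then have tile: "((\<lambda>v. cis (- 2 * pi * \<omega> * v) * of_bool (in_tile s a x v)) has_integral
      cis (- 2 * pi * \<omega> * H) * tile_weight s \<omega> a b) {H..H + s $ b}"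
  \<comment> \<open>At the two endpoints membership may differ from \<open>b = a\<close>, because of
    the neighbouring tiles; two points do not change the integral.\<close>
  proof (rule has_integral_spike_finite[of "{H, H + s $ b}", rotated 2])
    fix v assume "v \<in> {H..H + s $ b} - {H, H + s $ b}"
    then have "in_tile s a x v \<longleftrightarrow> b = a"
      unfolding b_def using H' by (intro in_tile_interior) (auto simp: H_def b_def)
    then show "cis (- 2 * pi * \<omega> * v) * of_bool (in_tile s a x v) = cis (- 2 * pi * \<omega> * v) * of_bool (b = a)"
      by simp
  qed simp
  have "subword x 0 (Suc N) = subword x 0 N @ [b]"
    by (simp add: subword_def b_def)
  then have "twisted_sum s (tile_weight s \<omega> a) \<omega> (subword x 0 (Suc N))
      = twisted_sum s (tile_weight s \<omega> a) \<omega> (subword x 0 N) + cis (- 2 * pi * \<omega> * H) * tile_weight s \<omega> a b"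
    by (simp add: twisted_sum_append H_def height_nat)
  then show ?case
    unfolding H' using H roof_pos[of b] Suc tile
    by (simp only:) (intro has_integral_combine[of 0 H], auto simp: H_def intro: less_imp_le)
qed

end

context self_similar_suspension
begin

sublocale positive_roof s
  by unfold_locales (rule s_pos)

text \<open>The orbit segment from \<open>u\<close> to \<open>u + R\<close> differs from the
  complete tiles on \<open>{0..H}\<close> by \<open>{0..u}\<close> and \<open>{H..u + R}\<close>,
  each no longer than \<open>s\<^sub>m\<^sub>a\<^sub>x\<close>; the complete tiles are treated by
  \<open>norm_tsum_subword_le\<close>.\<close>

lemma norm_orbit_integral_le:
  assumes p: "(x, u) \<in> susp_space \<zeta> s" and R: "0 \<le> R"
    and bd: "twisted_weights.level_bound \<zeta> s \<theta> (tile_weight s \<omega> a) \<omega> n M"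
  shows "cmod (integral {0..R} (\<lambda>t. cis (- 2 * pi * \<omega> * t) * of_bool (in_tile s a x (u + t))))
    \<le> M * (R + s\<^sub>m\<^sub>a\<^sub>x) + 2 * \<theta> ^ n * s\<^sub>m\<^sub>a\<^sub>x + 2 * s\<^sub>m\<^sub>a\<^sub>x"
proof -
  interpret twisted_weights \<zeta> s \<theta> s\<^sub>m\<^sub>a\<^sub>x "tile_weight s \<omega> a" \<omega>
    by unfold_locales (rule norm_tile_weight_le)
  note x = susp_spaceD[OF p]
  have M: "0 \<le> M" using bd by (simp add: level_bound_def)
  obtain k where k: "height s x k \<le> u + R" "u + R < height s x (k + 1)"
    using height_ex1[OF s_pos, of x "u + R"] by blast
  have "0 \<le> k"
  proof (rule ccontr)
    assume "\<not> 0 \<le> k"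
    then have "height s x (k + 1) \<le> 0"
      using s_nonneg by (simp add: height_def sum_nonneg)
    with k x R show False by linarith
  qed
  then obtain N where N: "k = int N" by (metis nonneg_int_cases)
  define H where "H = height s x (int N)"
  define F where "F v = cis (- 2 * pi * \<omega> * v) * of_bool (in_tile s a x v)" for v
  have norm_F: "cmod (F v) \<le> 1" for v by (simp add: F_def norm_mult)
  have H: "0 \<le> H" by (simp add: H_def height_nat wlen_nonneg)
  have HR: "H \<le> u + R" "u + R \<le> H + s\<^sub>m\<^sub>a\<^sub>x"
    using k s_max[of "x (int N)"] height_Suc[of s x "int N"] by (auto simp: N H_def)
  have F_H: "(F has_integral tsum (subword x 0 N)) {0..H}"
    using has_integral_tiles[of \<omega> a x N] unfolding F_def H_def .
  have F_int: "F integrable_on {0..height s x (int (Suc N))}"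
    using has_integral_tiles[of \<omega> a x "Suc N"] unfolding F_def by (rule has_integral_integrable)
  have "u + R \<le> height s x (int (Suc N))"
    using k by (simp add: N add.commute)
  then have int: "F integrable_on {c..d}" if "0 \<le> c" "d \<le> u + R" for c d
    using that by (intro integrable_on_subinterval[OF F_int]) auto
  have bound: "cmod (integral {c..d} F) \<le> s\<^sub>m\<^sub>a\<^sub>x" if "0 \<le> c" "c \<le> d" "d \<le> u + R" "d \<le> c + s\<^sub>m\<^sub>a\<^sub>x" for c d
  proof -
    have "cmod (integral {c..d} F) \<le> 1 * measure lborel (cbox c d)"
      using int[of c d] that norm_F by (intro has_integral_bound[of 1 F]) (auto simp: integrable_integral)
    with that show ?thesis by simp
  qed
  have "integral {0..u + R} F = integral {0..H} F + integral {H..u + R} F"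
    by (rule Henstock_Kurzweil_Integration.integral_combine[symmetric]) (use H HR int[of 0 "u + R"] in auto)
  moreover have "integral {0..u + R} F = integral {0..u} F + integral {u..u + R} F"
    by (rule Henstock_Kurzweil_Integration.integral_combine[symmetric]) (use x R int[of 0 "u + R"] in auto)
  moreover have "integral {0..H} F = tsum (subword x 0 N)"
    using F_H by (rule integral_unique)
  ultimately have "integral {u..u + R} F
      = tsum (subword x 0 N) + integral {H..u + R} F - integral {0..u} F"
    by (simp add: algebra_simps)
  then have "cmod (integral {u..u + R} F)
      \<le> cmod (tsum (subword x 0 N)) + cmod (integral {H..u + R} F) + cmod (integral {0..u} F)"
    by (simp add: norm_triangle_le_diff norm_triangle_mono)
  also have "\<dots> \<le> (M * wlen s (subword x 0 N) + 2 * \<theta> ^ n * s\<^sub>m\<^sub>a\<^sub>x) + s\<^sub>m\<^sub>a\<^sub>x + s\<^sub>m\<^sub>a\<^sub>x"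
    using x R H HR s_max[of "x 0"] norm_tsum_subword_le[OF bd x(1), of 0 N]
      bound[of H "u + R"] bound[of 0 u] by linarith
  also have "M * wlen s (subword x 0 N) \<le> M * (R + s\<^sub>m\<^sub>a\<^sub>x)"
    using M x HR s_max[of "x 0"] by (intro mult_left_mono) (auto simp: H_def simp flip: height_nat)
  finally have main: "cmod (integral {u..u + R} F) \<le> M * (R + s\<^sub>m\<^sub>a\<^sub>x) + 2 * \<theta> ^ n * s\<^sub>m\<^sub>a\<^sub>x + 2 * s\<^sub>m\<^sub>a\<^sub>x"
    by simp
  \<comment> \<open>Substituting \<open>v = u + t\<close> costs only the unimodular factor
    \<open>cis (2 * pi * \<omega> * u)\<close>.\<close>
  have "(F has_integral integral {u..u + R} F) {u..u + R}"
    using int x R by (intro integrable_integral) auto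
  then have "((\<lambda>t. F (t + u)) has_integral integral {u..u + R} F) {u - u..u + R - u}"
    by (rule has_integral_shift_real_ivl)
  then have "((\<lambda>t. cis (2 * pi * \<omega> * u) * F (t + u)) has_integral
      cis (2 * pi * \<omega> * u) * integral {u..u + R} F) {0..R}"
    by (intro has_integral_mult_right) simp
  also have "(\<lambda>t. cis (2 * pi * \<omega> * u) * F (t + u))
      = (\<lambda>t. cis (- 2 * pi * \<omega> * t) * of_bool (in_tile s a x (u + t)))"
    unfolding F_def mult.assoc[symmetric] cis_mult
    by (simp add: fun_eq_iff algebra_simps)
  finally show ?thesis
    using main by (simp add: integral_unique norm_mult)
qed

end

section \<open>Spectral measures of small intervals\<close>

lemma borel_measurable_cnj [measurable]: "cnj \<in> borel_measurable borel"
  by (intro borel_measurable_continuous_onI continuous_intros)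

lemma borel_measurable_cis [measurable]: "cis \<in> borel_measurable borel"
  by (intro borel_measurable_continuous_onI continuous_intros)

text \<open>The squared modulus is a double integral, and boundedness allows the exchange with
  \<open>N\<close>. The lemma is applied with the invariant measure and with the spectral measure as
  \<open>N\<close>.\<close>

lemma integral_square_Fubini:
  fixes g :: "'b \<Rightarrow> 'c \<Rightarrow> complex"
  assumes "finite_measure L" "finite_measure N"
    and g [measurable]: "(\<lambda>(t, p). g t p) \<in> borel_measurable (L \<Otimes>\<^sub>M N)"
    and le: "\<And>t p. cmod (g t p) \<le> 1"
  shows "(\<integral>p. of_real ((cmod (\<integral>t. g t p \<partial>L))\<^sup>2) \<partial>N)
       = (\<integral>z. (\<integral>p. g (fst z) p * cnj (g (snd z) p) \<partial>N) \<partial>(L \<Otimes>\<^sub>M L))"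
proof -
  interpret L: finite_measure L by fact
  interpret N: finite_measure N by fact
  interpret LL: pair_sigma_finite L L ..
  interpret LL: finite_measure "L \<Otimes>\<^sub>M L" by (rule finite_measure_pair_measure) fact+
  interpret LLN: pair_sigma_finite "L \<Otimes>\<^sub>M L" N ..
  interpret LLN: finite_measure "(L \<Otimes>\<^sub>M L) \<Otimes>\<^sub>M N" by (rule finite_measure_pair_measure) unfold_locales
  have prod_le: "cmod (g t p * cnj (g t' p')) \<le> 1" for t t' p p'
    using mult_mono[OF le[of t p] le[of t' p']] by (simp add: norm_mult)
  have inner: "complex_of_real ((cmod (\<integral>t. g t p \<partial>L))\<^sup>2)
      = (\<integral>z. g (fst z) p * cnj (g (snd z) p) \<partial>(L \<Otimes>\<^sub>M L))" if p: "p \<in> space N" for p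
  proof -
    have gp: "(\<lambda>t. g t p) \<in> borel_measurable L"
      using measurable_compose[OF measurable_Pair2'[OF p] g] by simp
    have [measurable]: "(\<lambda>z. g (fst z) p) \<in> borel_measurable (L \<Otimes>\<^sub>M L)"
      "(\<lambda>z. g (snd z) p) \<in> borel_measurable (L \<Otimes>\<^sub>M L)"
      using measurable_compose[OF measurable_fst gp] measurable_compose[OF measurable_snd gp] .
    have "integrable (L \<Otimes>\<^sub>M L) (\<lambda>z. g (fst z) p * cnj (g (snd z) p))"
      using prod_le by (intro LL.integrable_const_bound[where B = 1]) auto
    then have "(\<integral>z. g (fst z) p * cnj (g (snd z) p) \<partial>(L \<Otimes>\<^sub>M L))
        = (\<integral>t. (\<integral>t'. g t p * cnj (g t' p) \<partial>L) \<partial>L)"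
      by (subst LL.integral_fst'[symmetric]) (auto simp: split_beta)
    also have "\<dots> = (\<integral>t. g t p * (\<integral>t'. cnj (g t' p) \<partial>L) \<partial>L)" by simp
    also have "\<dots> = (\<integral>t. g t p \<partial>L) * cnj (\<integral>t. g t p \<partial>L)" by simp
    finally show ?thesis by (simp only: complex_norm_square)
  qed
  have "integrable ((L \<Otimes>\<^sub>M L) \<Otimes>\<^sub>M N) (\<lambda>(z, p). g (fst z) p * cnj (g (snd z) p))"
    using prod_le by (intro LLN.integrable_const_bound[where B = 1]) auto
  from LLN.Fubini_integral[OF this]
  have "(\<integral>p. (\<integral>z. g (fst z) p * cnj (g (snd z) p) \<partial>(L \<Otimes>\<^sub>M L)) \<partial>N)
    = (\<integral>z. (\<integral>p. g (fst z) p * cnj (g (snd z) p) \<partial>N) \<partial>(L \<Otimes>\<^sub>M L))" .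
  then show ?thesis
    by (subst Bochner_Integration.integral_cong[OF refl inner]) auto
qed

lemma exp_eq_cis: "exp (2 * of_real pi * \<i> * of_real \<omega> * of_real t) = cis (2 * pi * \<omega> * t)"
  by (simp add: cis_conv_exp mult_ac)

text \<open>Invariance turns the mean square of \<open>S\<close> into the integral of the squared
  modulus of the kernel \<open>D\<close> against \<open>\<sigma>\<close>; within
  \<open>1 / (6 * R)\<close> of \<open>\<omega>\<close> the kernel has modulus at least
  \<open>R / 2\<close>.\<close>

lemma spectral_measure_window:
  fixes f :: "'x \<Rightarrow> complex" and \<sigma> :: "real measure"
  assumes "prob_space M" and inv: "flow_invariant M h"
    and add: "\<And>t t' p. p \<in> space M \<Longrightarrow> h t (h t' p) = h (t + t') p"
    and f [measurable]: "f \<in> borel_measurable M" and f_le: "\<And>p. cmod (f p) \<le> 1"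
    and joint: "(\<lambda>(t, p). f (h t p)) \<in> borel_measurable (borel \<Otimes>\<^sub>M M)"
    and \<sigma>: "spectral_measure M h f \<sigma>"
    and R: "0 < R"
    and K: "\<And>p. p \<in> space M \<Longrightarrow> cmod (LINT t:{0..R}|lborel. cis (- 2 * pi * \<omega> * t) * f (h t p)) \<le> K"
  shows "(R / 2)\<^sup>2 * measure \<sigma> {\<omega> - 1 / (6 * R)..\<omega> + 1 / (6 * R)} \<le> K\<^sup>2"
proof -
  interpret prob_space M by fact
  have h: "h t \<in> M \<rightarrow>\<^sub>M M" and distr: "distr M M (h t) = M" for t
    using inv by (auto simp: flow_invariant_def)
  have sets_\<sigma> [measurable_cong]: "sets \<sigma> = sets borel" and fin_\<sigma>: "finite_measure \<sigma>"
    and corr: "\<And>t. (\<integral>w. cis (2 * pi * w * t) \<partial>\<sigma>) = (\<integral>p. f (h t p) * cnj (f p) \<partial>M)"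
    using \<sigma> by (auto simp: spectral_measure_def exp_eq_cis)
  interpret \<sigma>: finite_measure \<sigma> by fact
  define L where "L = density lborel (\<lambda>t. ennreal (indicator {0..R} t))"
  have sets_L [measurable_cong]: "sets L = sets borel" by (simp add: L_def)
  have int_L: "(\<integral>t. F t \<partial>L) = (LINT t:{0..R}|lborel. F t)" if [measurable]: "F \<in> borel_measurable borel"
    for F :: "real \<Rightarrow> complex"
    unfolding L_def set_lebesgue_integral_def by (subst integral_density) auto
  have emeasure_L: "emeasure L (space L) = ennreal R"
    unfolding L_def using R by (subst emeasure_density) (auto simp: ennreal_indicator)
  have fin_L: "finite_measure L"
    by (rule finite_measureI) (simp add: emeasure_L)
  interpret L: finite_measure L by fact
  have "measure L (space L) = R"
    using R by (simp add: measure_def emeasure_L)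
  define e where "e t = cis (- 2 * pi * \<omega> * t)" for t
  have e [measurable]: "e \<in> borel_measurable borel"
    unfolding e_def by (intro borel_measurable_continuous_onI continuous_intros)
  define S where "S p = (\<integral>t. e t * f (h t p) \<partial>L)" for p
  define D where "D w = (\<integral>t. cis (2 * pi * (w - \<omega>) * t) \<partial>L)" for w
  have "(\<integral>p. complex_of_real ((cmod (S p))\<^sup>2) \<partial>M)
      = (\<integral>z. (\<integral>p. (e (fst z) * f (h (fst z) p)) * cnj (e (snd z) * f (h (snd z) p)) \<partial>M) \<partial>(L \<Otimes>\<^sub>M L))"
    unfolding S_def
  proof (rule integral_square_Fubini[OF fin_L])
    show "finite_measure M" by (rule finite_measure_axioms)
    have "(\<lambda>(t, p). f (h t p)) \<in> borel_measurable (L \<Otimes>\<^sub>M M)"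
      using joint by (simp cong: measurable_cong_sets sets_pair_measure_cong add: sets_L)
    moreover have "(\<lambda>z. e (fst z)) \<in> borel_measurable (L \<Otimes>\<^sub>M M)"
      by measurable
    ultimately show "(\<lambda>(t, p). e t * f (h t p)) \<in> borel_measurable (L \<Otimes>\<^sub>M M)"
      unfolding split_beta by (rule borel_measurable_times[rotated])
    show "cmod (e t * f (h t p)) \<le> 1" for t p
      using f_le by (simp add: norm_mult e_def)
  qed
  also have "\<dots> = (\<integral>z. (\<integral>w. cis (2 * pi * (w - \<omega>) * fst z) * cnj (cis (2 * pi * (w - \<omega>) * snd z)) \<partial>\<sigma>) \<partial>(L \<Otimes>\<^sub>M L))"
  proof (intro Bochner_Integration.integral_cong refl)
    fix z :: "real \<times> real"
    obtain t t' where z: "z = (t, t')" by (cases z)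
    \<comment> \<open>Invariance under \<open>h t'\<close> makes the correlation depend on
      \<open>t - t'\<close> only, so the spectral measure applies.\<close>
    have "(\<integral>p. f (h t p) * cnj (f (h t' p)) \<partial>M)
        = (\<integral>p. f (h (t - t') (h t' p)) * cnj (f (h t' p)) \<partial>M)"
      by (intro Bochner_Integration.integral_cong refl) (simp add: add)
    also have "\<dots> = (\<integral>p. f (h (t - t') p) * cnj (f p) \<partial>distr M M (h t'))"
      using measurable_compose[OF h f] by (subst integral_distr[OF h]) auto
    also have "\<dots> = (\<integral>w. cis (2 * pi * w * (t - t')) \<partial>\<sigma>)"
      by (simp add: distr corr)
    finally have *: "(\<integral>p. f (h t p) * cnj (f (h t' p)) \<partial>M) = (\<integral>w. cis (2 * pi * w * (t - t')) \<partial>\<sigma>)" .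
    have "(\<integral>p. (e t * f (h t p)) * cnj (e t' * f (h t' p)) \<partial>M)
        = (\<integral>p. (e t * cnj (e t')) * (f (h t p) * cnj (f (h t' p))) \<partial>M)"
      by (simp add: mult_ac)
    also have "\<dots> = (e t * cnj (e t')) * (\<integral>w. cis (2 * pi * w * (t - t')) \<partial>\<sigma>)"
      by (simp add: *)
    also have "\<dots> = (\<integral>w. (e t * cnj (e t')) * cis (2 * pi * w * (t - t')) \<partial>\<sigma>)"
      by simp
    also have "\<dots> = (\<integral>w. cis (2 * pi * (w - \<omega>) * t) * cnj (cis (2 * pi * (w - \<omega>) * t')) \<partial>\<sigma>)"
      by (intro Bochner_Integration.integral_cong refl) (simp add: e_def cis_cnj cis_mult algebra_simps)
    finally show "(\<integral>p. (e (fst z) * f (h (fst z) p)) * cnj (e (snd z) * f (h (snd z) p)) \<partial>M)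
        = (\<integral>w. cis (2 * pi * (w - \<omega>) * fst z) * cnj (cis (2 * pi * (w - \<omega>) * snd z)) \<partial>\<sigma>)"
      by (simp add: z)
  qed
  also have "\<dots> = (\<integral>w. complex_of_real ((cmod (D w))\<^sup>2) \<partial>\<sigma>)"
    unfolding D_def
  proof (rule integral_square_Fubini[OF fin_L fin_\<sigma>, symmetric])
    show "(\<lambda>(t, w). cis (2 * pi * (w - \<omega>) * t)) \<in> borel_measurable (L \<Otimes>\<^sub>M \<sigma>)"
      by measurable
  qed simp
  finally have eq: "(\<integral>p. (cmod (S p))\<^sup>2 \<partial>M) = (\<integral>w. (cmod (D w))\<^sup>2 \<partial>\<sigma>)"
    by (simp only: integral_complex_of_real of_real_eq_iff)
  have S_le: "cmod (S p) \<le> K" if p: "p \<in> space M" for p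
  proof -
    have "(\<lambda>t. f (h t p)) \<in> borel_measurable borel"
      using measurable_compose[OF measurable_Pair2'[OF p] joint] by simp
    then have "(\<lambda>t. e t * f (h t p)) \<in> borel_measurable borel"
      by (rule borel_measurable_times[OF e])
    then have "S p = (LINT t:{0..R}|lborel. e t * f (h t p))"
      unfolding S_def by (rule int_L)
    with K[OF p] show ?thesis by (simp add: e_def)
  qed
  have "(\<integral>p. (cmod (S p))\<^sup>2 \<partial>M) \<le> K\<^sup>2"
  \<comment> \<open>The integral of a non-integrable function is 0 by convention, so the bound holds
    in both cases.\<close>
  proof (cases "integrable M (\<lambda>p. (cmod (S p))\<^sup>2)")
    case True
    then show ?thesis
      using S_le by (intro integral_le_const) (auto intro!: AE_I2 power_mono)
  qed (simp add: not_integrable_integral_eq)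
  moreover have "(R / 2)\<^sup>2 * measure \<sigma> {\<omega> - 1 / (6 * R)..\<omega> + 1 / (6 * R)} \<le> (\<integral>w. (cmod (D w))\<^sup>2 \<partial>\<sigma>)"
  proof -
    define I where "I = {\<omega> - 1 / (6 * R)..\<omega> + 1 / (6 * R)}"
    have D_le: "cmod (D w) \<le> R" for w
    proof -
      have "cmod (D w) \<le> (\<integral>t. 1 \<partial>L)"
        unfolding D_def by (rule order_trans[OF integral_norm_bound]) simp
      then show ?thesis using \<open>measure L (space L) = R\<close> by simp
    qed
    have [measurable]: "D \<in> borel_measurable \<sigma>"
      unfolding D_def by measurable
    have D_ge: "R / 2 \<le> cmod (D w)" if w: "w \<in> I" for w
    proof -
      have "(\<integral>t. 1 / 2 \<partial>L) \<le> (\<integral>t. cos (2 * pi * (w - \<omega>) * t) \<partial>L)"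
      proof (rule integral_mono_AE)
        show "integrable L (\<lambda>t. cos (2 * pi * (w - \<omega>) * t))"
          by (rule L.integrable_const_bound[where B = 1]) auto
        \<comment> \<open>On this window the phase is at most \<open>2 * pi / 6 = pi / 3\<close>,
          with cosine 1/2: this is where the 6 comes from.\<close>
        have "1 / 2 \<le> cos (2 * pi * (w - \<omega>) * t)" if t: "t \<in> {0..R}" for t
        proof -
          have "\<bar>w - \<omega>\<bar> \<le> 1 / (6 * R)" using w by (auto simp: I_def)
          then have "\<bar>w - \<omega>\<bar> * \<bar>t\<bar> \<le> 1 / (6 * R) * R"
            using t R by (intro mult_mono) auto
          then have "\<bar>2 * pi * (w - \<omega>) * t\<bar> \<le> pi / 3"
            using R by (simp add: abs_mult mult.assoc)
          then have "cos (pi / 3) \<le> cos \<bar>2 * pi * (w - \<omega>) * t\<bar>"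
            by (intro cos_monotone_0_pi_le) auto
          then show ?thesis by (simp add: cos_60)
        qed
        then show "AE t in L. 1 / 2 \<le> cos (2 * pi * (w - \<omega>) * t)"
          unfolding L_def by (subst AE_density) (auto simp: indicator_def)
      qed simp
      also have "(\<integral>t. cos (2 * pi * (w - \<omega>) * t) \<partial>L) = Re (D w)"
      proof -
        have "integrable L (\<lambda>t. cis (2 * pi * (w - \<omega>) * t))"
          by (rule L.integrable_const_bound[where B = 1]) auto
        then show ?thesis unfolding D_def by (subst integral_Re[symmetric]) auto
      qed
      also have "\<dots> \<le> cmod (D w)" by (rule complex_Re_le_cmod)
      finally show ?thesis using \<open>measure L (space L) = R\<close> by simp
    qed
    have I: "I \<in> sets \<sigma>" by (simp add: I_def sets_\<sigma>)
    have "(R / 2)\<^sup>2 * measure \<sigma> I = (\<integral>w. (R / 2)\<^sup>2 * indicator I w \<partial>\<sigma>)"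
      using I by simp
    also have "\<dots> \<le> (\<integral>w. (cmod (D w))\<^sup>2 \<partial>\<sigma>)"
    proof (rule integral_mono)
      show "integrable \<sigma> (\<lambda>w. (cmod (D w))\<^sup>2)"
        using D_le by (intro \<sigma>.integrable_const_bound[where B = "R\<^sup>2"]) (auto intro!: AE_I2 power_mono)
      show "integrable \<sigma> (\<lambda>w. (R / 2)\<^sup>2 * indicator I w)"
        using I by (intro integrable_mult_right \<sigma>.integrable_const_bound[where B = 1]) auto
      show "(R / 2)\<^sup>2 * indicator I w \<le> (cmod (D w))\<^sup>2" for w
        using D_ge[of w] R by (cases "w \<in> I") (auto intro!: power_mono simp del: power_divide)
    qed
    finally show ?thesis by (simp add: I_def)
  qed
  ultimately show ?thesis by (simp add: eq)
qed

section \<open>The logarithmic modulus of continuity\<close>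

context self_similar_suspension
begin

lemma spectral_measure_cylinder_le:
  assumes "prob_space \<mu>" and sets: "sets \<mu> = sets (susp_algebra \<zeta> s)"
    and inv: "flow_invariant \<mu> (susp_flow s)"
    and spec: "spectral_measure \<mu> (susp_flow s) (indicator (susp_cylinder \<zeta> s a)) \<sigma>"
    and R: "0 < R"
    and bd: "twisted_weights.level_bound \<zeta> s \<theta> (tile_weight s \<omega> a) \<omega> n M"
  shows "(R / 2)\<^sup>2 * measure \<sigma> {\<omega> - 1 / (6 * R)..\<omega> + 1 / (6 * R)}
    \<le> (M * (R + s\<^sub>m\<^sub>a\<^sub>x) + 2 * \<theta> ^ n * s\<^sub>m\<^sub>a\<^sub>x + 2 * s\<^sub>m\<^sub>a\<^sub>x)\<^sup>2"
proof -
  define f :: "_ \<Rightarrow> complex" where "f = indicator (susp_cylinder \<zeta> s a)"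
  have space: "space \<mu> = susp_space \<zeta> s"
    using sets_eq_imp_space_eq[OF sets] by (simp add: space_susp_algebra)
  have f_flow: "f (susp_flow s t p) = of_bool (in_tile s a (fst p) (snd p + t))" if "p \<in> space \<mu>" for t p
    using that susp_flow_in_cylinder_iff[of "fst p" "snd p"] by (simp add: f_def space indicator_def)
  have tile: "(\<lambda>(t, p). of_bool (in_tile s a (fst p) (snd p + t)) :: complex) \<in> borel_measurable (borel \<Otimes>\<^sub>M \<mu>)"
    using measurable_compose[OF measurable_in_tile[OF sets, of a], of "of_bool :: bool \<Rightarrow> complex" borel]
    by (simp add: case_prod_unfold)
  have joint: "(\<lambda>(t, p). f (susp_flow s t p)) \<in> borel_measurable (borel \<Otimes>\<^sub>M \<mu>)"
    by (subst measurable_cong[OF _, of _ _ "\<lambda>(t, p). of_bool (in_tile s a (fst p) (snd p + t))"])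
      (use tile in \<open>auto simp: space_pair_measure f_flow\<close>)
  show ?thesis
  proof (rule spectral_measure_window[OF assms(1) inv, where f = f])
    show "susp_flow s t (susp_flow s t' p) = susp_flow s (t + t') p" for t t' p
      by (rule susp_flow_add)
    show "f \<in> borel_measurable \<mu>"
      using susp_cylinder_sets[OF sets s_pos] unfolding f_def by (rule borel_measurable_indicator)
    show "cmod (f p) \<le> 1" for p by (simp add: f_def indicator_def)
    show "spectral_measure \<mu> (susp_flow s) f \<sigma>" using spec by (simp add: f_def)
    show "cmod (LINT t:{0..R}|lborel. cis (- 2 * pi * \<omega> * t) * f (susp_flow s t p))
        \<le> M * (R + s\<^sub>m\<^sub>a\<^sub>x) + 2 * \<theta> ^ n * s\<^sub>m\<^sub>a\<^sub>x + 2 * s\<^sub>m\<^sub>a\<^sub>x" if p: "p \<in> space \<mu>" for p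
    proof -
      define F where "F t = cis (- 2 * pi * \<omega> * t) * of_bool (in_tile s a (fst p) (snd p + t))" for t
      have "(\<lambda>t. of_bool (in_tile s a (fst p) (snd p + t)) :: complex) \<in> borel_measurable (borel :: real measure)"
        using measurable_compose[OF measurable_Pair2'[OF p] tile] by simp
      moreover have "(\<lambda>t. cis (- 2 * pi * \<omega> * t)) \<in> borel_measurable borel" by measurable
      ultimately have "F \<in> borel_measurable lborel"
        unfolding F_def by simp
      moreover have F_norm: "cmod (F t) \<le> 1" for t by (simp add: F_def norm_mult)
      ultimately have "set_integrable lborel {0..R} F"
        unfolding set_integrable_def
        by (intro integrableI_bounded_set_indicator[where B = 1]) (auto simp: F_norm emeasure_lborel_Icc_eq)
      \<comment> \<open>Passes from the Lebesgue integral to the Henstock-Kurzweil integral, for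
        which the orbit bound is stated.\<close>
      then have "(LINT t:{0..R}|lborel. F t) = integral {0..R} F"
        by (rule set_borel_integral_eq_integral)
      moreover have "cmod (integral {0..R} F) \<le> M * (R + s\<^sub>m\<^sub>a\<^sub>x) + 2 * \<theta> ^ n * s\<^sub>m\<^sub>a\<^sub>x + 2 * s\<^sub>m\<^sub>a\<^sub>x"
        unfolding F_def using p R by (intro norm_orbit_integral_le[OF _ _ bd]) (auto simp: space)
      ultimately show ?thesis using p by (simp add: f_flow F_def)
    qed
  qed (use joint R in auto)
qed

end

text \<open>With \<open>\<theta> ^ n\<close> about \<open>sqrt R\<close> the edge terms are of order
  \<open>sqrt R\<close>, while \<open>n\<close> is still of order \<open>ln R\<close>, so the decay
  in \<open>n\<close> becomes decay in \<open>ln R\<close>.\<close>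

lemma log_scale_estimate:
  fixes \<theta> \<gamma> C S R :: real
  assumes \<theta>: "1 < \<theta>" and \<gamma>: "0 < \<gamma>" and C: "0 < C" and S: "0 < S" "S \<le> R"
    and R: "1 < R" and n0: "4 * ln \<theta> * (real n0 + 1) \<le> ln R"
  obtains n where "n0 \<le> n"
    "(C * real n powr (- \<gamma>) * (R + S) + 2 * \<theta> ^ n * S + 2 * S)\<^sup>2
      \<le> (8 * C\<^sup>2 * (4 * ln \<theta>) powr (2 * \<gamma>) + 32 * S\<^sup>2 * (2 * \<gamma>) powr (2 * \<gamma>)) * R\<^sup>2 * ln R powr (- (2 * \<gamma>))"
proof -
  \<comment> \<open>Solves \<open>\<theta> powr z = sqrt R\<close>. The hypothesis on
    \<open>n0\<close> gives \<open>z \<ge> 2\<close>, so rounding down to \<open>n\<close> loses at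
    most a factor 2.\<close>
  define z where "z = ln R / (2 * ln \<theta>)"
  have ln\<theta>: "0 < ln \<theta>" using \<theta> by simp
  have lnR: "0 < ln R" using R by simp
  have z: "2 * real n0 + 2 \<le> z" using n0 ln\<theta> by (simp add: z_def field_simps)
  define n where "n = nat \<lfloor>z\<rfloor>"
  have n: "real n \<le> z" "z - 1 \<le> real n"
  proof -
    have "0 \<le> z" using z by linarith
    then have "real n = of_int \<lfloor>z\<rfloor>" by (simp add: n_def)
    then show "real n \<le> z" "z - 1 \<le> real n" by linarith+
  qed
  define M where "M = C * real n powr (- \<gamma>)"
  have n_ge: "ln R / (4 * ln \<theta>) \<le> real n"
  proof -
    have "ln R / (4 * ln \<theta>) = z / 2" by (simp add: z_def)
    also have "\<dots> \<le> real n" using n z by linarith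
    finally show ?thesis .
  qed
  have M2: "M\<^sup>2 \<le> C\<^sup>2 * ((4 * ln \<theta>) powr (2 * \<gamma>) * ln R powr (- (2 * \<gamma>)))"
  proof -
    have "M\<^sup>2 = C\<^sup>2 * real n powr (- (2 * \<gamma>))"
      by (simp add: M_def power_mult_distrib power2_eq_square flip: powr_add)
    also have "real n powr (- (2 * \<gamma>)) \<le> (ln R / (4 * ln \<theta>)) powr (- (2 * \<gamma>))"
      using n_ge \<gamma> lnR ln\<theta> by (intro powr_mono2') auto
    also have "\<dots> = (4 * ln \<theta>) powr (2 * \<gamma>) * ln R powr (- (2 * \<gamma>))"
      using lnR ln\<theta> by (simp add: powr_divide powr_minus field_simps)
    finally show ?thesis by (simp add: mult_left_mono)
  qed
  have \<theta>n: "\<theta> ^ n \<le> sqrt R"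
  proof -
    have "\<theta> ^ n = \<theta> powr real n" using \<theta> by (simp add: powr_realpow)
    also have "\<dots> \<le> \<theta> powr z" using \<theta> n by (intro powr_mono) auto
    also have "\<dots> = exp (ln R / 2)" using \<theta> ln\<theta> by (simp add: powr_def z_def)
    also have "\<dots> = sqrt R" using R by (simp add: powr_half_sqrt[symmetric] powr_def)
    finally show ?thesis .
  qed
  have sq: "1 \<le> sqrt R" using R by simp
  have M0: "0 \<le> M" using C by (simp add: M_def)
  have "M * (R + S) + 2 * \<theta> ^ n * S + 2 * S \<le> M * (2 * R) + 4 * S * sqrt R"
  proof -
    have "M * (R + S) \<le> M * (2 * R)" using M0 S by (intro mult_left_mono) auto
    moreover have "\<theta> ^ n * S \<le> sqrt R * S" "1 * S \<le> sqrt R * S"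
      using \<theta>n sq S by (auto intro!: mult_right_mono)
    ultimately show ?thesis by (simp add: mult_ac)
  qed
  then have "(M * (R + S) + 2 * \<theta> ^ n * S + 2 * S)\<^sup>2 \<le> (M * (2 * R) + 4 * S * sqrt R)\<^sup>2"
    using M0 S R \<theta> by (intro power_mono) auto
  also have "\<dots> \<le> 2 * (M * (2 * R))\<^sup>2 + 2 * (4 * S * sqrt R)\<^sup>2"
    using sum_squares_bound[of "M * (2 * R)" "4 * S * sqrt R"] by (simp add: power2_sum)
  also have "\<dots> = 8 * M\<^sup>2 * R\<^sup>2 + 32 * S\<^sup>2 * R"
    using R by (simp add: power_mult_distrib)
  also have "\<dots> \<le> 8 * (C\<^sup>2 * ((4 * ln \<theta>) powr (2 * \<gamma>) * ln R powr (- (2 * \<gamma>)))) * R\<^sup>2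
      + 32 * S\<^sup>2 * ((2 * \<gamma>) powr (2 * \<gamma>) * ln R powr (- (2 * \<gamma>)) * R\<^sup>2)"
  proof (intro add_mono mult_left_mono mult_right_mono M2)
    \<comment> \<open>The edge terms contribute only \<open>R\<close> to the square, and the spare
      factor \<open>R\<close> dominates the power of \<open>ln R\<close>.\<close>
    have "ln R powr (2 * \<gamma>) \<le> (2 * \<gamma>) powr (2 * \<gamma>) * R"
      using R \<gamma> by (intro ln_powr_bound2) auto
    then have "1 \<le> (2 * \<gamma>) powr (2 * \<gamma>) * ln R powr (- (2 * \<gamma>)) * R"
      using lnR by (simp add: powr_minus field_simps)
    then have "R * 1 \<le> R * ((2 * \<gamma>) powr (2 * \<gamma>) * ln R powr (- (2 * \<gamma>)) * R)"
      using R by (intro mult_left_mono) auto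
    then show "R \<le> (2 * \<gamma>) powr (2 * \<gamma>) * ln R powr (- (2 * \<gamma>)) * R\<^sup>2"
      by (simp add: power2_eq_square mult_ac)
  qed auto
  also have "\<dots> = (8 * C\<^sup>2 * (4 * ln \<theta>) powr (2 * \<gamma>) + 32 * S\<^sup>2 * (2 * \<gamma>) powr (2 * \<gamma>)) * R\<^sup>2 * ln R powr (- (2 * \<gamma>))"
    by (simp add: algebra_simps)
  finally have "(M * (R + S) + 2 * \<theta> ^ n * S + 2 * S)\<^sup>2 \<le> \<dots>" .
  moreover have "n0 \<le> n" using n z by linarith
  ultimately show ?thesis using that[of n] by (simp add: M_def)
qed

theorem theorem5p1:
  fixes \<zeta> :: "'a::finite \<Rightarrow> 'a list"
    and \<theta> :: real and \<theta>\<^sub>2 :: complex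
    and s :: "real^'a"
    and \<mu> :: "((int \<Rightarrow> 'a) \<times> real) measure"
    and \<sigma> :: "'a \<Rightarrow> real measure"
  assumes "CARD('a) \<ge> 2"
    and "substitution \<zeta>" and "primitive \<zeta>" and "aperiodic \<zeta>"
    and "perron_frobenius_eigenvalue (subst_matrix \<zeta>) \<theta>"
    and "galois_conjugate (complex_of_real \<theta>) \<theta>\<^sub>2"
    and "\<theta>\<^sub>2 \<noteq> complex_of_real \<theta>" and "cmod \<theta>\<^sub>2 > 1"
    and "\<And>j. s $ j > 0" and "transpose (subst_matrix \<zeta>) *v s = \<theta> *s s"
    and "prob_space \<mu>" and "sets \<mu> = sets (susp_algebra \<zeta> s)"
    and "flow_invariant \<mu> (susp_flow s)"
    and "\<And>a. spectral_measure \<mu> (susp_flow s)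
               (indicator (susp_cylinder \<zeta> s a)) (\<sigma> a)"
  shows "\<exists>\<gamma>>0. \<forall>B>1. \<exists>C>0. \<exists>r\<^sub>0>0. \<forall>r a \<omega>.
           0 < r \<longrightarrow> r \<le> r\<^sub>0 \<longrightarrow> \<bar>\<omega>\<bar> \<in> {1 / B..B} \<longrightarrow>
           measure (\<sigma> a) {\<omega> - r..\<omega> + r} \<le> C * ln (1 / r) powr (- \<gamma>)"
proof -
  have "0 < \<theta>" using assms(5) by (simp add: perron_frobenius_eigenvalue_def)
  then have \<theta>: "1 < \<theta>"
    using primitive_dilation_gt_1[OF assms(3,1,9) _ assms(10)] by blast
  obtain p where p: "p \<noteq> 0" "ipoly p \<theta> = 0" "ipoly p \<theta>\<^sub>2 = 0"
    and minimal: "\<And>Q. ipoly Q \<theta>\<^sub>2 = 0 \<Longrightarrow> degree Q < degree p \<Longrightarrow> Q = 0"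
    using galois_conjugate_minimal_polynomial[OF assms(6)] by metis
  define S where "S = Max (range (($) s))"
  interpret self_similar_suspension \<zeta> s \<theta> S
    by unfold_locales (use assms(9,10) \<theta> in \<open>auto simp: S_def\<close>)
  have S: "0 < S" by (rule s_max_pos)
  obtain \<gamma> where \<gamma>: "0 < \<gamma>" and decay: "\<And>B. 1 < B \<Longrightarrow> \<exists>C>0. \<exists>n\<^sub>0>0. \<forall>\<omega> f n. 1 / B \<le> \<bar>\<omega>\<bar> \<longrightarrow>
      \<bar>\<omega>\<bar> \<le> B \<longrightarrow> (\<forall>b. cmod (f b) \<le> s $ b) \<longrightarrow> n\<^sub>0 \<le> n \<longrightarrow>
      twisted_weights.level_bound \<zeta> s \<theta> f \<omega> n (C * real n powr (- \<gamma>))"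
    using level_bound_decay[OF assms(3,1)
        powers_not_near_integers[OF p(1,3,2) minimal assms(7,8) \<theta>]] by blast
  show ?thesis
  \<comment> \<open>The exponent doubles because the spectral bound is quadratic in the orbit
    integral.\<close>
  proof (rule exI[of _ "2 * \<gamma>"], intro conjI allI impI)
    show "0 < 2 * \<gamma>" using \<gamma> by simp
  next
    fix B :: real assume "1 < B"
    then obtain C n0 where C: "0 < C" and bd: "\<And>\<omega> f n. 1 / B \<le> \<bar>\<omega>\<bar> \<Longrightarrow> \<bar>\<omega>\<bar> \<le> B \<Longrightarrow>
        (\<forall>b. cmod (f b) \<le> s $ b) \<Longrightarrow> n0 \<le> n \<Longrightarrow>
        twisted_weights.level_bound \<zeta> s \<theta> f \<omega> n (C * real n powr (- \<gamma>))"
      using decay by metis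
    define K where "K = 8 * C\<^sup>2 * (4 * ln \<theta>) powr (2 * \<gamma>) + 32 * S\<^sup>2 * (2 * \<gamma>) powr (2 * \<gamma>)"
    have K: "0 < K" unfolding K_def using C \<theta> S \<gamma> by (intro add_pos_pos mult_pos_pos) auto
    \<comment> \<open>6 gives \<open>6 * R \<le> R\<^sup>2\<close>, \<open>S\<close> gives
      \<open>R + S \<le> 2 * R\<close>, and the exponential is the threshold of
      \<open>log_scale_estimate\<close>.\<close>
    define R0 where "R0 = Max {6, S, exp (4 * ln \<theta> * (real n0 + 1))}"
    have R0: "6 \<le> R0" "S \<le> R0" "exp (4 * ln \<theta> * (real n0 + 1)) \<le> R0"
      by (auto simp: R0_def)
    show "\<exists>C>0. \<exists>r\<^sub>0>0. \<forall>r a \<omega>. 0 < r \<longrightarrow> r \<le> r\<^sub>0 \<longrightarrow> \<bar>\<omega>\<bar> \<in> {1 / B..B} \<longrightarrow>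
        measure (\<sigma> a) {\<omega> - r..\<omega> + r} \<le> C * ln (1 / r) powr (- (2 * \<gamma>))"
    \<comment> \<open>The 4 comes from \<open>(R / 2)\<^sup>2\<close>, the power of 2 from replacing
      \<open>ln R\<close> by \<open>ln (1 / r) / 2\<close>.\<close>
    proof (rule exI[of _ "4 * K * 2 powr (2 * \<gamma>)"], intro conjI, use K in simp,
        rule exI[of _ "1 / (6 * R0)"], intro conjI allI impI)
      show "0 < 1 / (6 * R0)" using R0 by simp
    next
      fix r a \<omega>
      assume r: "0 < r" "r \<le> 1 / (6 * R0)" and \<omega>: "\<bar>\<omega>\<bar> \<in> {1 / B..B}"
      define R where "R = 1 / (6 * r)"
      have "R0 \<le> R" using r R0 by (simp add: R_def field_simps)
      with R0 have R: "6 \<le> R" "S \<le> R" "exp (4 * ln \<theta> * (real n0 + 1)) \<le> R" by linarith+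
      have lnR: "4 * ln \<theta> * (real n0 + 1) \<le> ln R"
        using R by (subst ln_ge_iff) auto
      obtain n where n: "n0 \<le> n" "(C * real n powr (- \<gamma>) * (R + S) + 2 * \<theta> ^ n * S + 2 * S)\<^sup>2
          \<le> K * R\<^sup>2 * ln R powr (- (2 * \<gamma>))"
        using log_scale_estimate[OF \<theta> \<gamma> C S R(2) _ lnR] R(1) unfolding K_def by auto
      have "(R / 2)\<^sup>2 * measure (\<sigma> a) {\<omega> - 1 / (6 * R)..\<omega> + 1 / (6 * R)}
          \<le> (C * real n powr (- \<gamma>) * (R + S) + 2 * \<theta> ^ n * S + 2 * S)\<^sup>2"
        using R \<omega> n norm_tile_weight_le
        by (intro spectral_measure_cylinder_le[OF assms(11-14)] bd) auto
      also note n(2)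
      also have "1 / (6 * R) = r" using r by (simp add: R_def)
      finally have "R\<^sup>2 * measure (\<sigma> a) {\<omega> - r..\<omega> + r} \<le> R\<^sup>2 * (4 * K * ln R powr (- (2 * \<gamma>)))"
        by (simp add: power_divide mult_ac)
      then have "measure (\<sigma> a) {\<omega> - r..\<omega> + r} \<le> 4 * K * ln R powr (- (2 * \<gamma>))"
        using R(1) by (subst (asm) mult_le_cancel_left_pos) auto
      also have "ln R powr (- (2 * \<gamma>)) \<le> (ln (1 / r) / 2) powr (- (2 * \<gamma>))"
      proof (rule powr_mono2')
        have "1 / r = 6 * R" by (simp add: R_def)
        also have "\<dots> \<le> R\<^sup>2" using R(1) by (simp add: power2_eq_square mult_right_mono)
        finally have "ln (1 / r) \<le> ln (R\<^sup>2)" using r by (intro ln_mono) auto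
        then show "ln (1 / r) / 2 \<le> ln R" using R(1) by (simp add: ln_realpow)
        have "1 < 1 / r" using R(1) \<open>1 / r = 6 * R\<close> by simp
        then show "0 < ln (1 / r) / 2" by (simp only: ln_gt_zero half_gt_zero)
      qed (use \<gamma> in simp)
      also have "(ln (1 / r) / 2) powr (- (2 * \<gamma>)) = 2 powr (2 * \<gamma>) * ln (1 / r) powr (- (2 * \<gamma>))"
      proof -
        have "1 < 1 / r" using R(1) r by (simp add: R_def field_simps)
        then have "0 \<le> ln (1 / r)" by (intro ln_ge_zero) simp
        then show ?thesis by (subst powr_divide) (auto simp: powr_minus field_simps)
      qed
      finally show "measure (\<sigma> a) {\<omega> - r..\<omega> + r}
          \<le> 4 * K * 2 powr (2 * \<gamma>) * ln (1 / r) powr (- (2 * \<gamma>))"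
        using K by (simp add: mult_ac)
    qed
  qed
qed

end
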